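(* There is an algorithm that, on input a finite hypergraph $(V,\mathcal{H})$ with a total order $\succcurlyeq$ on $V$, enumerates all minimal hitting sets of $\mathcal{H}$, each exactly once, in lexicographically ascending order, with delay $O(m^{k^*+2}n^2)$ between consecutive outputs, where $n=|V|$, $m=|\mathcal{H}|$ and $k^*$ is the maximum cardinality of a minimal hitting set of $\mathcal{H}$; the algorithm uses only polynomial space. (The algorithm is not given $k^*$ as input.)
   Context: A hypergraph is a finite set $V$ with a collection $\mathcal{H}\subseteq\mathcal{P}(V)$ of edges (empty edges allowed). A hitting set of $\mathcal{H}$ is $H\subseteq V$ meeting every edge; it is minimal if no proper subset is a hitting set. The lexicographical order induced by $\succcurlyeq$: $S\preccurlyeq_{\mathrm{lex}}T$ iff $S=T$ or $\min_{\succcurlyeq}(S\triangle T)\in S$, where $\min_\succcurlyeq$ is the $\succcurlyeq$-first element. The delay is the maximum time between the start and the first output, between any two consecutive outputs, and between the last output and termination. $k^*$ is the rank of the transversal hypergraph $Tr(\mathcal{H})$ (the hypergraph of all minimal hitting sets). *)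

theory Defs
  imports
    "HOL-Library.Log_Nat"
    "HOL-Computational_Algebra.Polynomial"
begin

section \<open>Hypergraphs and minimal hitting sets\<close>

definition hypergraph :: "'a set \<Rightarrow> 'a set set \<Rightarrow> bool" where
  "hypergraph V H \<longleftrightarrow> finite V \<and> H \<subseteq> Pow V"

definition hitting_set :: "'a set \<Rightarrow> 'a set set \<Rightarrow> 'a set \<Rightarrow> bool" where
  "hitting_set V H T \<longleftrightarrow> T \<subseteq> V \<and> (\<forall>E\<in>H. T \<inter> E \<noteq> {})"

definition minimal_hitting_set :: "'a set \<Rightarrow> 'a set set \<Rightarrow> 'a set \<Rightarrow> bool" where
  "minimal_hitting_set V H T \<longleftrightarrow> hitting_set V H T \<and> \<not> (\<exists>T'. T' \<subset> T \<and> hitting_set V H T')"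

definition Tr :: "'a set \<Rightarrow> 'a set set \<Rightarrow> 'a set set" where
  "Tr V H = {T. minimal_hitting_set V H T}"

text \<open>A hypergraph without edges has rank 0. For a transversal hypergraph this happens exactly
  if the original hypergraph contains the empty edge.\<close>

definition hrank :: "'a set set \<Rightarrow> nat" where
  "hrank H = (if H = {} then 0 else Max (card ` H))"

text \<open>A pair \<open>(x, y)\<close> of the total order \<open>r\<close> means that \<open>x\<close> equals \<open>y\<close> or comes before it.\<close>

definition first :: "'a rel \<Rightarrow> 'a set \<Rightarrow> 'a" where
  "first r A = (THE x. x \<in> A \<and> (\<forall>y\<in>A. (x, y) \<in> r))"

definition lex_le :: "'a rel \<Rightarrow> 'a set \<Rightarrow> 'a set \<Rightarrow> bool" where
  "lex_le r S T \<longleftrightarrow> S = T \<or> first r ((S - T) \<union> (T - S)) \<in> S"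


section \<open>The machine model\<close>

text \<open>Programs are those of a word RAM in structured form. The memory consists of arrays of natural
  numbers, where a program can address only the arrays it names; a scalar variable is an array
  of which only cell 0 is used. Expressions have fixed size within a program, so that every step
  below stands for a constant number of machine operations. \<open>Minus\<close> is truncated subtraction.\<close>

type_synonym store = "string \<Rightarrow> nat \<Rightarrow> nat"

datatype exp = N nat | Cell string exp | Plus exp exp | Minus exp exp | Times exp exp

fun val :: "exp \<Rightarrow> store \<Rightarrow> nat" where
  "val (N k) s = k"
| "val (Cell a e) s = s a (val e s)"
| "val (Plus e f) s = val e s + val f s"
| "val (Minus e f) s = val e s - val f s"
| "val (Times e f) s = val e s * val f s"

text \<open>\<open>Assign a i e\<close> is \<open>a[i] := e\<close>. Conditions hold if their value is nonzero. An output is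
  printed number by number with \<open>Write\<close> and completed by \<open>Output\<close>; the output medium cannot
  be read back.\<close>

datatype com =
    Skip
  | Assign string exp exp
  | Write exp
  | Output
  | Seq com com
  | Cond exp com com
  | While exp com

text \<open>Small-step semantics. Every step takes one unit of time and is labelled by exactly one event,
  so the length of a list of events is the time that has passed.\<close>

datatype event = Tick | Put nat | Flush

inductive step :: "com \<times> store \<Rightarrow> event \<Rightarrow> com \<times> store \<Rightarrow> bool" where
  "step (Assign a i e, s) Tick (Skip, s(a := (s a)(val i s := val e s)))"
| "step (Write e, s) (Put (val e s)) (Skip, s)"
| "step (Output, s) Flush (Skip, s)"
| "step (Seq Skip c, s) Tick (c, s)"
| "step (c, s) l (c', s') \<Longrightarrow> step (Seq c d, s) l (Seq c' d, s')"
| "val e s \<noteq> 0 \<Longrightarrow> step (Cond e c d, s) Tick (c, s)"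
| "val e s = 0 \<Longrightarrow> step (Cond e c d, s) Tick (d, s)"
| "step (While e c, s) Tick (Cond e (Seq c (While e c)) Skip, s)"

inductive steps :: "com \<times> store \<Rightarrow> event list \<Rightarrow> com \<times> store \<Rightarrow> bool" where
  "steps cf [] cf"
| "step cf l cf' \<Longrightarrow> steps cf' ls cf'' \<Longrightarrow> steps cf (l # ls) cf''"

inductive_cases SkipE: "step (Skip, s) l cf"
inductive_cases AssignE: "step (Assign a i e, s) l cf"
inductive_cases WriteE: "step (Write e, s) l cf"
inductive_cases OutputE: "step (Output, s) l cf"
inductive_cases SeqE: "step (Seq c d, s) l cf"
inductive_cases CondE: "step (Cond e c d, s) l cf"
inductive_cases WhileE: "step (While e c, s) l cf"

lemma step_deterministic:
  "step cf l cf' \<Longrightarrow> step cf l' cf'' \<Longrightarrow> l' = l \<and> cf'' = cf'"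
proof (induction arbitrary: l' cf'' rule: step.induct)
  case (5 c s l c' s' d)
  have "c \<noteq> Skip"
    using 5(1) by (auto elim: SkipE)
  with 5(3) obtain c'' s'' where "step (c, s) l' (c'', s'')" "cf'' = (Seq c'' d, s'')"
    by (auto elim: SeqE)
  with 5(2) show ?case by blast
qed (auto elim: SkipE AssignE WriteE OutputE CondE WhileE SeqE[of Skip])

text \<open>The completed outputs of a run; the first argument holds what has been printed since the
  last completed output.\<close>

fun outputs_from :: "nat list \<Rightarrow> event list \<Rightarrow> nat list list" where
  "outputs_from xs [] = []"
| "outputs_from xs (Tick # ls) = outputs_from xs ls"
| "outputs_from xs (Put k # ls) = outputs_from (xs @ [k]) ls"
| "outputs_from xs (Flush # ls) = xs # outputs_from [] ls"

definition outputs :: "event list \<Rightarrow> nat list list" where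
  "outputs ls = outputs_from [] ls"

text \<open>The times from the start to the first output, between consecutive outputs, and from the last
  output to termination; the first argument is the time since the last output.\<close>

fun gaps_from :: "nat \<Rightarrow> event list \<Rightarrow> nat list" where
  "gaps_from t [] = [t]"
| "gaps_from t (l # ls) = (if l = Flush then Suc t # gaps_from 0 ls else gaps_from (Suc t) ls)"

definition delay :: "event list \<Rightarrow> nat" where
  "delay ls = Max (set (gaps_from 0 ls))"

text \<open>Unit cost per step is adequate since the memory words are required to be logarithmically short:
  the stored numbers are bounded by \<open>B\<close>, which will be polynomial in the size of the input.\<close>

definition words_bounded :: "nat \<Rightarrow> store \<Rightarrow> bool" where
  "words_bounded B s \<longleftrightarrow> (\<forall>a i. s a i \<le> B)"

text \<open>Space is measured in bits, namely those of the addresses and contents of all nonzero cells.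
  The input is included; all cells outside it initially contain 0.\<close>

definition space_bounded :: "nat \<Rightarrow> store \<Rightarrow> bool" where
  "space_bounded B s \<longleftrightarrow>
     finite {(a, i). s a i \<noteq> 0} \<and>
     (\<Sum>(a, i) \<in> {(a, i). s a i \<noteq> 0}. floorlog 2 i + floorlog 2 (s a i)) \<le> B"


section \<open>Input and output of the enumeration problem\<close>

text \<open>The vertices and the edges are numbered from 0 in an arbitrary way, by their positions in \<open>vs\<close> and
  \<open>es\<close>; in particular the numbering is unrelated to \<open>r\<close>. The input consists of the numbers of
  vertices and edges, the 0-1 matrix of \<open>r\<close> and the edge-vertex incidence matrix, stored row by row.\<close>

definition input :: "'a list \<Rightarrow> 'a set list \<Rightarrow> 'a rel \<Rightarrow> store" where
  "input vs es r = (\<lambda>_ _. 0)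
     (''n'' := (\<lambda>_. 0)(0 := length vs),
      ''m'' := (\<lambda>_. 0)(0 := length es),
      ''ord'' := (\<lambda>k. if k < length vs * length vs \<and>
                        (vs ! (k div length vs), vs ! (k mod length vs)) \<in> r then 1 else 0),
      ''inc'' := (\<lambda>k. if k < length es * length vs \<and>
                        vs ! (k mod length vs) \<in> es ! (k div length vs) then 1 else 0))"

definition represents :: "'a list \<Rightarrow> nat list \<Rightarrow> 'a set \<Rightarrow> bool" where
  "represents vs xs T \<longleftrightarrow> distinct xs \<and> set xs \<subseteq> {..<length vs} \<and> T = (\<lambda>j. vs ! j) ` set xs"

definition enumerates_lex :: "'a list \<Rightarrow> 'a rel \<Rightarrow> nat list list \<Rightarrow> 'a set set \<Rightarrow> bool" where
  "enumerates_lex vs r out F \<longleftrightarrow>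
     (\<exists>Ts. list_all2 (represents vs) out Ts \<and> distinct Ts \<and> set Ts = F \<and> sorted_wrt (lex_le r) Ts)"

end

(* The search tree branches on the vertices in their given order, "in" before "out". A node is a set X
   of chosen vertices among the first i. It leads to a minimal hitting set iff every vertex of X can be
   given an edge meeting X only in that vertex such that the later vertices outside all these edges hit
   every edge missed by X. Trying all m^|X| choices of edges, each in O(m n) steps, decides this. As only
   children of extendible nodes are tested, |X| <= k* + 1, and O(n) tests separate consecutive outputs.
   The choices are enumerated by an odometer in base m, since their number need not fit into a word. *)
theory Submission
  imports Defs
begin

section \<open>Big-step execution and weakest preconditions\<close>

text \<open>One check takes at most a multiple of (n + 1) (|X| + m + 1) steps, so O(m n) presupposes
  |X| = O(m). This holds since the vertices of a minimal hitting set own pairwise different edges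
  meeting the set only there, whence k* <= m. The two factors m beyond m^k* stem from the one vertex
  by which a tested child may exceed an extendible set, and from the edges scanned by a check. The
  rank k* occurs in the analysis only. The claims on words and space concern every store reached,
  also inside unfinished loops, whereas correctness and time are easier to derive for whole
  commands. Hence a big-step semantics that carries the bounds, and a transfer to single steps by
  determinism. As the input numbering is unrelated to the order, the program first computes the
  permutation that sorts the vertices. The analysis of the search then lives on the positions {..<n}
  with their natural order, and its result is carried to the given vertices by a bijection.\<close>

text \<open>The relation \<open>exec B\<close> exists only for runs in which every assigned cell has index and new value
  at most \<open>B\<close>; this is what bounds the words and the space in all intermediate states.\<close>

inductive exec :: "nat \<Rightarrow> com \<Rightarrow> store \<Rightarrow> event list \<Rightarrow> store \<Rightarrow> bool" for B where
  exec_Skip: "exec B Skip s [] s"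
| exec_Assign: "val i s \<le> B \<Longrightarrow> val e s \<le> B \<Longrightarrow>
    exec B (Assign a i e) s [Tick] (s(a := (s a)(val i s := val e s)))"
| exec_Write: "exec B (Write e) s [Put (val e s)] s"
| exec_Output: "exec B Output s [Flush] s"
| exec_Seq: "exec B c s ls s' \<Longrightarrow> exec B d s' ls' s'' \<Longrightarrow> exec B (Seq c d) s (ls @ Tick # ls') s''"
| exec_CondT: "val e s \<noteq> 0 \<Longrightarrow> exec B c s ls s' \<Longrightarrow> exec B (Cond e c d) s (Tick # ls) s'"
| exec_CondF: "val e s = 0 \<Longrightarrow> exec B d s ls s' \<Longrightarrow> exec B (Cond e c d) s (Tick # ls) s'"
| exec_While: "exec B (Cond e (Seq c (While e c)) Skip) s ls s' \<Longrightarrow> exec B (While e c) s (Tick # ls) s'"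

inductive_cases exec_SkipE: "exec B Skip s ls s'"
inductive_cases exec_AssignE: "exec B (Assign a i e) s ls s'"
inductive_cases exec_SeqE: "exec B (Seq c d) s ls s'"
inductive_cases exec_CondE: "exec B (Cond e c d) s ls s'"

fun writes :: "com \<Rightarrow> string set" where
  "writes (Assign a i e) = {a}"
| "writes (Seq c d) = writes c \<union> writes d"
| "writes (Cond e c d) = writes c \<union> writes d"
| "writes (While e c) = writes c"
| "writes _ = {}"

lemma finite_writes: "finite (writes c)"
  by (induction c) auto

lemma exec_frame: "exec B c s ls s' \<Longrightarrow> a \<notin> writes c \<Longrightarrow> s' a = s a"
  by (induction rule: exec.induct) auto

section \<open>Runs with an invariant on every store passed\<close>

inductive path :: "(store \<Rightarrow> bool) \<Rightarrow> com \<times> store \<Rightarrow> event list \<Rightarrow> com \<times> store \<Rightarrow> bool" for I where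
  path_refl: "I (snd cf) \<Longrightarrow> path I cf [] cf"
| path_step: "I (snd cf) \<Longrightarrow> step cf l cf' \<Longrightarrow> path I cf' ls cf'' \<Longrightarrow> path I cf (l # ls) cf''"

lemma path_append: "path I cf ls cf' \<Longrightarrow> path I cf' ls' cf'' \<Longrightarrow> path I cf (ls @ ls') cf''"
  by (induction rule: path.induct) (auto intro: path.intros)

lemma path_Seq: "path I (c, s) ls (c', s') \<Longrightarrow> path I (Seq c d, s) ls (Seq c' d, s')"
proof (induction "(c, s)" ls "(c', s')" arbitrary: c s rule: path.induct)
  case path_refl
  then show ?case by (auto intro: path.path_refl)
next
  case (path_step l cf' ls)
  obtain c1 s1 where cf': "cf' = (c1, s1)" by fastforce
  have "step (Seq c d, s) l (Seq c1 d, s1)"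
    using path_step(2) cf' by (auto intro: step.intros)
  moreover have "path I (Seq c1 d, s1) ls (Seq c' d, s')"
    using path_step cf' by blast
  ultimately show ?case
    using path_step(1) by (simp add: path.path_step)
qed

lemma path_steps: "path I cf ls cf' \<Longrightarrow> steps cf ls cf'"
  by (induction rule: path.induct) (auto intro: steps.intros)

text \<open>As \<open>step\<close> is deterministic and \<open>Skip\<close> is stuck, every partial
  run is an initial piece of the one terminating run. An invariant known along that run thus holds
  in all reachable stores.\<close>

lemma path_reachable:
  assumes "path I cf ls (Skip, s')" and "steps cf ls' cf'"
  shows "I (snd cf')"
  using assms
proof (induction cf ls "(Skip, s')" arbitrary: ls' rule: path.induct)
  case path_refl
  from path_refl(2) show ?case
    using path_refl(1) by cases (auto elim: SkipE)
next
  case (path_step cf l cf1 ls)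
  from path_step(5) show ?case
  proof cases
    case 1
    then show ?thesis using path_step(1) by simp
  next
    case (2 l' cf2 ls2)
    with path_step(2) have "cf2 = cf1" by (blast dest: step_deterministic)
    with 2 path_step(4) show ?thesis by blast
  qed
qed

text \<open>Addresses and array names are confined as well as contents. This makes the nonzero cells
  finite in number and gives their total bit length a polynomial bound.\<close>

definition cells_bounded :: "nat \<Rightarrow> string set \<Rightarrow> store \<Rightarrow> bool" where
  "cells_bounded B A s \<longleftrightarrow> (\<forall>a i. s a i \<le> B \<and> (s a i \<noteq> 0 \<longrightarrow> a \<in> A \<and> i \<le> B))"

text \<open>Only assignments change the store, and their rule in \<open>exec\<close> carries exactly
  the two bounds needed.\<close>

lemma exec_path:
  assumes "exec B c s ls s'" and "writes c \<subseteq> A" and "cells_bounded B A s"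
  shows "path (cells_bounded B A) (c, s) ls (Skip, s') \<and> cells_bounded B A s'"
  using assms
proof (induction rule: exec.induct)
  case (exec_Assign i s e a)
  then have "cells_bounded B A (s(a := (s a)(val i s := val e s)))"
    by (auto simp: cells_bounded_def)
  moreover have "step (Assign a i e, s) Tick (Skip, s(a := (s a)(val i s := val e s)))"
    by (rule step.intros)
  ultimately show ?case
    using exec_Assign by (metis path.path_step path.path_refl snd_conv)
next
  case (exec_Seq c s ls s' d ls' s'')
  then have *: "path (cells_bounded B A) (Seq c d, s) ls (Seq Skip d, s')"
    and s': "cells_bounded B A s'"
    by (auto intro: path_Seq)
  have "path (cells_bounded B A) (Seq Skip d, s') (Tick # ls') (Skip, s'')"
    using exec_Seq s' path.path_step[OF _ step.intros(4)] by simp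
  with * show ?case
    using exec_Seq s' by (auto intro: path_append)
next
  case (exec_CondT e s c ls s' d)
  then have "step (Cond e c d, s) Tick (c, s)" by (auto intro: step.intros)
  with exec_CondT show ?case by (simp add: path.path_step)
next
  case (exec_CondF e s d ls s' c)
  then have "step (Cond e c d, s) Tick (d, s)" by (auto intro: step.intros)
  with exec_CondF show ?case by (simp add: path.path_step)
next
  case (exec_While e c s ls s')
  have "step (While e c, s) Tick (Cond e (Seq c (While e c)) Skip, s)" by (rule step.intros)
  with exec_While show ?case by (simp add: path.path_step)
next
  case (exec_Write e s)
  have "step (Write e, s) (Put (val e s)) (Skip, s)" by (rule step.intros)
  with exec_Write show ?case by (simp add: path.path_step path.path_refl)
next
  case (exec_Output s)
  have "step (Output, s) Flush (Skip, s)" by (rule step.intros)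
  with exec_Output show ?case by (simp add: path.path_step path.path_refl)
qed (simp_all add: path.path_refl)

lemma floorlog_le_self: "floorlog 2 x \<le> x"
proof -
  have "x < 2 ^ x" by simp
  then show ?thesis by (intro floorlog_leI) auto
qed

text \<open>Estimating the length of a number by the number itself is crude, but enough because
  \<open>B\<close> will be polynomial.\<close>

lemma cells_bounded_space:
  assumes "cells_bounded B A s" and "finite A"
  shows "space_bounded (card A * (B + 1) * (2 * B)) s"
proof -
  let ?Z = "{(a, i). s a i \<noteq> 0}"
  have sub: "?Z \<subseteq> A \<times> {..B}"
    using assms by (auto simp: cells_bounded_def)
  have fin: "finite ?Z"
    using sub assms by (meson finite_SigmaI finite_atMost finite_subset)
  have "(\<Sum>(a, i) \<in> ?Z. floorlog 2 i + floorlog 2 (s a i)) \<le> of_nat (card ?Z) * (2 * B)"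
  proof (rule sum_bounded_above, clarify)
    fix a i assume "s a i > 0"
    then have "i \<le> B" "s a i \<le> B" using assms by (auto simp: cells_bounded_def)
    then show "floorlog 2 i + floorlog 2 (s a i) \<le> 2 * B"
      using floorlog_le_self[of i] floorlog_le_self[of "s a i"] by linarith
  qed
  also have "card ?Z \<le> card (A \<times> {..B})"
    using sub assms by (intro card_mono) auto
  finally show ?thesis
    using fin by (simp add: space_bounded_def card_cartesian_product)
qed

text \<open>Total correctness for code without output: as all events are ticks, their number is the
  running time. Printing code is treated directly with \<open>exec\<close>.\<close>

definition wp :: "nat \<Rightarrow> com \<Rightarrow> (nat \<Rightarrow> store \<Rightarrow> bool) \<Rightarrow> store \<Rightarrow> bool" where
  "wp B c Q s \<longleftrightarrow> (\<exists>ls s'. exec B c s ls s' \<and> set ls \<subseteq> {Tick} \<and> Q (length ls) s')"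

lemma wp_Skip[simp]: "wp B Skip Q s \<longleftrightarrow> Q 0 s"
proof
  assume "wp B Skip Q s"
  then show "Q 0 s" unfolding wp_def by (elim exE conjE exec_SkipE) simp
next
  assume "Q 0 s"
  then show "wp B Skip Q s"
    unfolding wp_def by (intro exI[of _ "[]"] exI[of _ s]) (simp add: exec_Skip)
qed

lemma wp_Assign[simp]: "wp B (Assign a i e) Q s \<longleftrightarrow>
    val i s \<le> B \<and> val e s \<le> B \<and> Q 1 (s(a := (s a)(val i s := val e s)))"
proof
  assume "wp B (Assign a i e) Q s"
  then show "val i s \<le> B \<and> val e s \<le> B \<and> Q 1 (s(a := (s a)(val i s := val e s)))"
    unfolding wp_def by (elim exE conjE exec_AssignE) simp
next
  assume "val i s \<le> B \<and> val e s \<le> B \<and> Q 1 (s(a := (s a)(val i s := val e s)))"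
  then show "wp B (Assign a i e) Q s"
    unfolding wp_def by (intro exI[of _ "[Tick]"] exI conjI) (auto intro: exec.intros)
qed

lemma wp_Seq[simp]: "wp B (Seq c d) Q s \<longleftrightarrow> wp B c (\<lambda>t s'. wp B d (\<lambda>t'. Q (t + t' + 1)) s') s"
proof
  assume "wp B (Seq c d) Q s"
  then obtain ls s' where *: "exec B (Seq c d) s ls s'" "set ls \<subseteq> {Tick}" "Q (length ls) s'"
    unfolding wp_def by auto
  from *(1) show "wp B c (\<lambda>t s'. wp B d (\<lambda>t'. Q (t + t' + 1)) s') s"
  proof (rule exec_SeqE)
    fix ls1 s1 ls2
    assume "ls = ls1 @ Tick # ls2" "exec B c s ls1 s1" "exec B d s1 ls2 s'"
    with * show ?thesis
      unfolding wp_def by (intro exI[of _ ls1] exI[of _ s1] exI[of _ ls2] exI[of _ s'] conjI) auto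
  qed
next
  assume "wp B c (\<lambda>t s'. wp B d (\<lambda>t'. Q (t + t' + 1)) s') s"
  then obtain ls1 s1 ls2 s' where "exec B c s ls1 s1" "exec B d s1 ls2 s'"
    "set ls1 \<subseteq> {Tick}" "set ls2 \<subseteq> {Tick}" "Q (length ls1 + length ls2 + 1) s'"
    unfolding wp_def by auto
  then show "wp B (Seq c d) Q s"
    unfolding wp_def by (intro exI[of _ "ls1 @ Tick # ls2"] exI[of _ s'] conjI exec_Seq) auto
qed

lemma wp_Cond[simp]:
  "wp B (Cond e c d) Q s \<longleftrightarrow>
     (if val e s \<noteq> 0 then wp B c (\<lambda>t. Q (t + 1)) s else wp B d (\<lambda>t. Q (t + 1)) s)"
proof
  assume "wp B (Cond e c d) Q s"
  then obtain ls s' where *: "exec B (Cond e c d) s ls s'" "set ls \<subseteq> {Tick}" "Q (length ls) s'"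
    unfolding wp_def by auto
  from *(1) obtain ls1 where "ls = Tick # ls1" "exec B (if val e s \<noteq> 0 then c else d) s ls1 s'"
    by (rule exec_CondE) (use that in \<open>auto split: if_splits\<close>)
  with *(2,3) show "if val e s \<noteq> 0 then wp B c (\<lambda>t. Q (t + 1)) s else wp B d (\<lambda>t. Q (t + 1)) s"
    unfolding wp_def by (simp split: if_splits) blast+
next
  assume "if val e s \<noteq> 0 then wp B c (\<lambda>t. Q (t + 1)) s else wp B d (\<lambda>t. Q (t + 1)) s"
  then obtain ls s' where "exec B (if val e s \<noteq> 0 then c else d) s ls s'" "set ls \<subseteq> {Tick}" "Q (length ls + 1) s'"
    unfolding wp_def by (auto split: if_splits)
  then show "wp B (Cond e c d) Q s"
    unfolding wp_def
    by (intro exI[of _ "Tick # ls"] exI[of _ s']) (auto split: if_splits intro: exec.intros)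
qed

lemma wp_unfold_While:
  "wp B (Cond e (Seq c (While e c)) Skip) (\<lambda>t. Q (t + 1)) s \<Longrightarrow> wp B (While e c) Q s"
proof -
  assume "wp B (Cond e (Seq c (While e c)) Skip) (\<lambda>t. Q (t + 1)) s"
  then obtain ls s' where "exec B (Cond e (Seq c (While e c)) Skip) s ls s'" "set ls \<subseteq> {Tick}"
    "Q (length ls + 1) s'"
    unfolding wp_def by auto
  then show ?thesis
    unfolding wp_def by (intro exI[of _ "Tick # ls"] exI[of _ s']) (auto intro: exec.intros)
qed

lemma wp_mono: "wp B c Q s \<Longrightarrow> (\<And>t s'. Q t s' \<Longrightarrow> Q' t s') \<Longrightarrow> wp B c Q' s"
  unfolding wp_def by blast

definition unchanged :: "com \<Rightarrow> store \<Rightarrow> store \<Rightarrow> bool" where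
  "unchanged c s s' \<longleftrightarrow> (\<forall>a. a \<notin> writes c \<longrightarrow> s' a = s a)"

lemma unchangedD: "unchanged c s s' \<Longrightarrow> a \<notin> writes c \<Longrightarrow> s' a = s a"
  by (simp add: unchanged_def)

lemma wp_frame: "wp B c Q s \<Longrightarrow> wp B c (\<lambda>t s'. Q t s' \<and> unchanged c s s') s"
  unfolding wp_def unchanged_def using exec_frame by blast

lemma wp_conseq:
  "wp B c Q s \<Longrightarrow> (\<And>t s'. Q t s' \<Longrightarrow> unchanged c s s' \<Longrightarrow> Q' t s') \<Longrightarrow> wp B c Q' s"
  by (rule wp_mono[OF wp_frame]) auto

text \<open>\<open>j\<close> is fuel bounding the rounds still to come; the loop may stop before it
  is used up, hence \<open>j'\<close> at the end. A round costs 3 beyond its body (unfolding, test,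
  sequencing), the exit 2. The body obtains \<open>unchanged\<close> relative to the initial store,
  so that invariants need to mention only what changes.\<close>

lemma wp_While:
  assumes "I j s"
    and step: "\<And>j s'. I j s' \<Longrightarrow> unchanged c s s' \<Longrightarrow> val e s' \<noteq> 0 \<Longrightarrow>
      0 < j \<and> wp B c (\<lambda>t s''. t \<le> C \<and> I (j - 1) s'') s'"
  shows "wp B (While e c)
    (\<lambda>t s'. t \<le> j * (C + 3) + 2 \<and> unchanged c s s' \<and> val e s' = 0 \<and> (\<exists>j'\<le>j. I j' s')) s"
proof -
  have "wp B (While e c) (\<lambda>t s''. t \<le> j * (C + 3) + 2 \<and> unchanged c s s'' \<and> val e s'' = 0 \<and>
      (\<exists>j'\<le>j. I j' s'')) s'"
    if "I j s'" "unchanged c s s'" for s'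
    using that
  proof (induction j arbitrary: s')
    case 0
    then have "val e s' = 0" using step by blast
    then show ?case using 0
      by (intro wp_unfold_While) auto
  next
    case (Suc j)
    show ?case
    proof (cases "val e s' = 0")
      case True
      then show ?thesis using Suc
        by (intro wp_unfold_While) auto
    next
      case False
      have body: "wp B c (\<lambda>t s''. t \<le> C \<and> I j s'') s'"
        using step[OF Suc(2,3) False] by simp
      have "wp B c (\<lambda>t s''. wp B (While e c) (\<lambda>t'' s''. t + t'' + 1 + 1 + 1 \<le> Suc j * (C + 3) + 2 \<and>
          unchanged c s s'' \<and> val e s'' = 0 \<and> (\<exists>j'\<le>Suc j. I j' s'')) s'') s'"
      proof (rule wp_conseq[OF body])
        fix t s1
        assume *: "t \<le> C \<and> I j s1" "unchanged c s' s1"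
        then have "unchanged c s s1" using Suc(3) by (auto simp: unchanged_def)
        with * have "wp B (While e c) (\<lambda>t s''. t \<le> j * (C + 3) + 2 \<and> unchanged c s s'' \<and>
            val e s'' = 0 \<and> (\<exists>j'\<le>j. I j' s'')) s1"
          using Suc.IH by blast
        then show "wp B (While e c) (\<lambda>t'' s''. t + t'' + 1 + 1 + 1 \<le> Suc j * (C + 3) + 2 \<and>
            unchanged c s s'' \<and> val e s'' = 0 \<and> (\<exists>j'\<le>Suc j. I j' s'')) s1"
        proof (rule wp_mono)
          fix t' s2
          assume A: "t' \<le> j * (C + 3) + 2 \<and> unchanged c s s2 \<and> val e s2 = 0 \<and> (\<exists>j'\<le>j. I j' s2)"
          moreover have "\<exists>j'\<le>Suc j. I j' s2" using A le_SucI by blast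
          ultimately show "t + t' + 1 + 1 + 1 \<le> Suc j * (C + 3) + 2 \<and>
            unchanged c s s2 \<and> val e s2 = 0 \<and> (\<exists>j'\<le>Suc j. I j' s2)"
            using *(1) by simp
        qed
      qed
      then show ?thesis
        using False by (intro wp_unfold_While) simp
    qed
  qed
  then show ?thesis using assms(1) by (simp add: unchanged_def)
qed

section \<open>Checking one choice of edges\<close>

abbreviation var :: "string \<Rightarrow> exp" where "var a \<equiv> Cell a (N 0)"
abbreviation assign :: "string \<Rightarrow> exp \<Rightarrow> com" where "assign a e \<equiv> Assign a (N 0) e"

text \<open>Truncated subtraction doubles as comparison: the difference is nonzero iff the counter
  is still below the limit. Later conditions use the same device, with products as conjunctions and
  \<open>1 - k\<close> as negation.\<close>

definition for_to :: "string \<Rightarrow> string \<Rightarrow> com \<Rightarrow> com" where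
  "for_to v b c = Seq (assign v (N 0)) (While (Minus (var b) (var v)) (Seq c (assign v (Plus (var v) (N 1)))))"

lemma writes_for_to[simp]: "writes (for_to v b c) = insert v (writes c)"
  by (auto simp: for_to_def)

text \<open>The 5 per round are the 3 of the loop and 2 for sequencing and increment; the 4 are
  initialization, its sequencing and the exit. After the body the invariant is demanded of the store
  with the counter advanced, because the next round begins there.\<close>

lemma wp_for_to:
  assumes K: "s b 0 = K" "K \<le> B" and b: "b \<noteq> v" "b \<notin> writes c" "v \<notin> writes c"
    and init: "I 0 (s(v := (s v)(0 := 0)))"
    and step: "\<And>k s'. I k s' \<Longrightarrow> unchanged (for_to v b c) s s' \<Longrightarrow> s' v 0 = k \<Longrightarrow> k < K \<Longrightarrow>
      wp B c (\<lambda>t s''. t \<le> C \<and> I (Suc k) (s''(v := (s'' v)(0 := Suc k)))) s'"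
  shows "wp B (for_to v b c)
    (\<lambda>t s'. t \<le> K * (C + 5) + 4 \<and> s' v 0 = K \<and> I K s') s"
proof -
  let ?s = "s(v := (s v)(0 := 0))"
  let ?c = "Seq c (assign v (Plus (var v) (N 1)))"
  define L where "L j s' \<longleftrightarrow> j \<le> K \<and> s' v 0 = K - j \<and> I (K - j) s'" for j s'
  have "wp B (While (Minus (var b) (var v)) ?c)
    (\<lambda>t s'. t \<le> K * (C + 2 + 3) + 2 \<and> unchanged ?c ?s s' \<and> val (Minus (var b) (var v)) s' = 0 \<and>
      (\<exists>j'\<le>K. L j' s')) ?s"
  proof (rule wp_While)
    show "L K ?s" using init by (simp add: L_def)
  next
    fix j s'
    assume *: "L j s'" "unchanged ?c ?s s'" "val (Minus (var b) (var v)) s' \<noteq> 0"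
    then have j: "0 < j" "j \<le> K"
      using unchangedD[OF *(2), of b] b K by (auto simp: L_def)
    have "unchanged (for_to v b c) s s'"
      using *(2) by (auto simp: unchanged_def for_to_def)
    then have "wp B c (\<lambda>t s''. t \<le> C \<and> I (Suc (K - j)) (s''(v := (s'' v)(0 := Suc (K - j))))) s'"
      using * j by (intro step) (auto simp: L_def)
    then have "wp B ?c (\<lambda>t s''. t \<le> C + 2 \<and> L (j - 1) s'') s'"
      unfolding wp_Seq
    proof (rule wp_conseq)
      fix t s''
      assume A: "t \<le> C \<and> I (Suc (K - j)) (s''(v := (s'' v)(0 := Suc (K - j))))" "unchanged c s' s''"
      then have "s'' v 0 = K - j" using * b by (auto simp: L_def unchanged_def)
      then show "wp B (assign v (Plus (var v) (N 1))) (\<lambda>t'. (\<lambda>t s''. t \<le> C + 2 \<and> L (j - 1) s'') (t + t' + 1)) s''"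
        using A(1) j K by (auto simp: L_def Suc_diff_le)
    qed
    then show "0 < j \<and> wp B ?c (\<lambda>t s''. t \<le> C + 2 \<and> L (j - 1) s'') s'"
      using j by simp
  qed
  then have "wp B (While (Minus (var b) (var v)) ?c)
    (\<lambda>t s'. t + 2 \<le> K * (C + 5) + 4 \<and> s' v 0 = K \<and> I K s') ?s"
  proof (rule wp_mono)
    fix t s'
    assume *: "t \<le> K * (C + 2 + 3) + 2 \<and> unchanged ?c ?s s' \<and> val (Minus (var b) (var v)) s' = 0 \<and>
      (\<exists>j'\<le>K. L j' s')"
    then have "s' b 0 = K" using K b by (auto simp: unchanged_def)
    moreover obtain j' where "j' \<le> K" "L j' s'" using * by blast
    ultimately have "L 0 s'" using * by (cases "j' = 0") (auto simp: L_def)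
    then show "t + 2 \<le> K * (C + 5) + 4 \<and> s' v 0 = K \<and> I K s'"
      using * by (auto simp: L_def algebra_simps)
  qed
  then show ?thesis
    by (simp add: for_to_def)
qed

text \<open>Vertices are addressed by their position in the order; \<open>p\<close> maps positions to the vertex numbers of
  the input. Below \<open>i\<close>, the array \<open>a\<close> is the indicator of the current node; \<open>L\<close> lists its \<open>x\<close> chosen
  vertices and \<open>w\<close> the edges tried for them, \<open>c\<close> counts for every vertex the edges of \<open>w\<close> containing
  it, \<open>g\<close> tells whether the choice \<open>w\<close> works and \<open>f\<close> whether the node is extendible.\<close>

definition inc_exp :: "exp \<Rightarrow> exp \<Rightarrow> exp" where
  "inc_exp e v = Cell ''inc'' (Plus (Times e (var ''n'')) (Cell ''p'' v))"

definition clear_counts :: com where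
  "clear_counts = for_to ''v'' ''n'' (Assign ''c'' (var ''v'') (N 0))"

definition add_counts :: com where
  "add_counts = for_to ''v'' ''n''
     (Assign ''c'' (var ''v'') (Plus (Cell ''c'' (var ''v'')) (inc_exp (Cell ''w'' (var ''j'')) (var ''v''))))"

definition count_all :: com where
  "count_all = for_to ''j'' ''x'' add_counts"

text \<open>The factor \<open>2 - c\<close> is a truth value whenever it matters: if the edge tried
  contains the vertex, that edge is itself counted, so c >= 1, and the truncated difference is 1 for
  c = 1 and 0 otherwise.\<close>

definition test_private :: com where
  "test_private = for_to ''j'' ''x''
     (assign ''g'' (Times (var ''g'') (Times (inc_exp (Cell ''w'' (var ''j'')) (Cell ''L'' (var ''j'')))
        (Minus (N 2) (Cell ''c'' (Cell ''L'' (var ''j'')))))))"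

text \<open>Below \<open>i\<close> only vertices of the node may hit; from \<open>i\<close> on, all
  vertices avoiding the chosen edges may, since \<open>1 - c\<close> is 1 just for c = 0. Every
  vertex adds at most 1 to \<open>h\<close>, so \<open>h\<close> stays within a word.\<close>

definition test_edge :: com where
  "test_edge = for_to ''v'' ''n''
     (Cond (Minus (var ''i'') (var ''v''))
       (assign ''h'' (Plus (var ''h'') (Times (inc_exp (var ''e'') (var ''v'')) (Cell ''a'' (var ''v'')))))
       (assign ''h'' (Plus (var ''h'') (Times (inc_exp (var ''e'') (var ''v'')) (Minus (N 1) (Cell ''c'' (var ''v'')))))))"

definition test_edges :: com where
  "test_edges = for_to ''e'' ''m''
     (Seq (assign ''h'' (N 0)) (Seq test_edge (Cond (var ''h'') Skip (assign ''g'' (N 0)))))"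

definition check :: com where
  "check = Seq clear_counts (Seq count_all (Seq (assign ''g'' (N 1)) (Seq test_private test_edges)))"

lemma writes_check[simp]:
  "writes clear_counts = {''v'', ''c''}" "writes add_counts = {''v'', ''c''}"
  "writes count_all = {''j'', ''v'', ''c''}" "writes test_private = {''j'', ''g''}"
  "writes test_edge = {''v'', ''h''}" "writes test_edges = {''e'', ''v'', ''h'', ''g''}"
  "writes check = {''v'', ''c'', ''j'', ''g'', ''e'', ''h''}"
  by (auto simp: clear_counts_def add_counts_def count_all_def test_private_def test_edge_def
      test_edges_def check_def)

text \<open>\<open>J\<close> is the incidence relation after renumbering the vertices by their
  position in the order. Positive \<open>m\<close> ensures that the digit 0 denotes an edge.
  \<open>B\<close> only has to cover counters of vertices and edges, as no stored value grows with
  the number of choices tried.\<close>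

locale incidence =
  fixes n m B :: nat and J :: "nat \<Rightarrow> nat \<Rightarrow> bool"
  assumes m_pos: "0 < m" and B_ge: "n + m + 1 \<le> B"
begin

definition loaded :: "store \<Rightarrow> bool" where
  "loaded s \<longleftrightarrow> s ''n'' 0 = n \<and> s ''m'' 0 = m \<and>
     (\<forall>e<m. \<forall>v<n. s ''inc'' (e * n + s ''p'' v) = of_bool (J e v))"

lemma loadedD: "loaded s \<Longrightarrow> s ''n'' 0 = n" "loaded s \<Longrightarrow> s ''m'' 0 = m"
  "loaded s \<Longrightarrow> e < m \<Longrightarrow> v < n \<Longrightarrow> s ''inc'' (e * n + s ''p'' v) = of_bool (J e v)"
  by (auto simp: loaded_def)

definition cnt :: "(nat \<Rightarrow> nat) \<Rightarrow> nat \<Rightarrow> nat \<Rightarrow> nat" where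
  "cnt w x v = (\<Sum>q<x. of_bool (J (w q) v))"

lemma cnt_simps[simp]: "cnt w 0 v = 0" "cnt w (Suc x) v = cnt w x v + of_bool (J (w x) v)"
  by (simp_all add: cnt_def)

lemma cnt_le: "cnt w x v \<le> x"
  by (induction x) auto

lemma wp_clear_counts:
  assumes "loaded s"
  shows "wp B clear_counts (\<lambda>t s'. t \<le> n * 6 + 4 \<and> (\<forall>u<n. s' ''c'' u = 0)) s"
proof -
  have "wp B clear_counts (\<lambda>t s'. t \<le> n * (1 + 5) + 4 \<and> s' ''v'' 0 = n \<and> (\<forall>u<n. s' ''c'' u = 0)) s"
    unfolding clear_counts_def
    by (rule wp_for_to[where I = "\<lambda>k s'. \<forall>u<k. s' ''c'' u = 0"])
      (use assms B_ge in \<open>auto simp: loadedD less_Suc_eq\<close>)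
  then show ?thesis by (rule wp_mono) auto
qed

lemma wp_add_counts:
  assumes "loaded s" "s ''j'' 0 = q" "s ''w'' q < m" "\<forall>u<n. s ''c'' u \<le> n"
  shows "wp B add_counts
    (\<lambda>t s'. t \<le> n * 6 + 4 \<and> (\<forall>u<n. s' ''c'' u = s ''c'' u + of_bool (J (s ''w'' q) u))) s"
proof -
  have "wp B add_counts (\<lambda>t s'. t \<le> n * (1 + 5) + 4 \<and> s' ''v'' 0 = n \<and>
      (\<forall>u<n. s' ''c'' u = s ''c'' u + (if u < n then of_bool (J (s ''w'' q) u) else 0))) s"
    unfolding add_counts_def
  proof (rule wp_for_to[where I = "\<lambda>k s'. \<forall>u<n. s' ''c'' u =
      s ''c'' u + (if u < k then of_bool (J (s ''w'' q) u) else 0)"], goal_cases)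
    case (7 k s')
    then have fr: "s' ''j'' = s ''j''" "s' ''w'' = s ''w''" "s' ''n'' = s ''n''"
      and st: "loaded s'"
      using assms(1) by (auto simp: unchanged_def loaded_def)
    have i: "s' ''inc'' (s ''w'' q * n + s' ''p'' k) = of_bool (J (s ''w'' q) k)"
      using st assms 7 by (simp add: loadedD)
    have "k \<le> B" "s ''c'' k + 1 \<le> B" using B_ge 7 assms by fastforce+
    then show ?case
      using 7 fr i st assms by (auto simp: inc_exp_def loadedD less_Suc_eq)
  qed (use assms B_ge in \<open>auto simp: loadedD\<close>)
  then show ?thesis by (rule wp_mono) auto
qed

lemma wp_count_all:
  assumes "loaded s" "s ''x'' 0 = x" "x \<le> n" "\<forall>q<x. s ''w'' q < m" "\<forall>u<n. s ''c'' u = 0"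
  shows "wp B count_all
    (\<lambda>t s'. t \<le> x * (n * 6 + 9) + 4 \<and> (\<forall>u<n. s' ''c'' u = cnt (s ''w'') x u)) s"
proof -
  have "wp B count_all (\<lambda>t s'. t \<le> x * ((n * 6 + 4) + 5) + 4 \<and> s' ''j'' 0 = x \<and>
      (\<forall>u<n. s' ''c'' u = cnt (s ''w'') x u)) s"
    unfolding count_all_def
  proof (rule wp_for_to[where I = "\<lambda>k s'. \<forall>u<n. s' ''c'' u = cnt (s ''w'') k u"], goal_cases)
    case (7 k s')
    then have fr: "s' ''w'' = s ''w''" and st: "loaded s'"
      using assms(1) by (auto simp: unchanged_def loaded_def)
    have "wp B add_counts
      (\<lambda>t s''. t \<le> n * 6 + 4 \<and> (\<forall>u<n. s'' ''c'' u = s' ''c'' u + of_bool (J (s' ''w'' k) u))) s'"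
      using 7 st fr assms le_trans[OF cnt_le[of "s ''w''" k], of n]
      by (intro wp_add_counts) auto
    then show ?case
      by (rule wp_mono) (use 7 fr in auto)
  qed (use assms B_ge in \<open>auto simp: loadedD\<close>)
  then show ?thesis by (rule wp_mono) (auto simp: algebra_simps)
qed

lemma wp_test_private:
  assumes "loaded s" "s ''x'' 0 = x" "x \<le> n" "\<forall>q<x. s ''w'' q < m" "\<forall>q<x. s ''L'' q < n"
    "\<forall>u<n. s ''c'' u = cnt (s ''w'') x u" "s ''g'' 0 = 1"
  shows "wp B test_private
    (\<lambda>t s'. t \<le> x * 6 + 4 \<and>
       s' ''g'' 0 = of_bool (\<forall>q<x. J (s ''w'' q) (s ''L'' q) \<and> cnt (s ''w'') x (s ''L'' q) = 1)) s"
proof -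
  have "wp B test_private (\<lambda>t s'. t \<le> x * (1 + 5) + 4 \<and> s' ''j'' 0 = x \<and>
      s' ''g'' 0 = of_bool (\<forall>q<x. J (s ''w'' q) (s ''L'' q) \<and> cnt (s ''w'') x (s ''L'' q) = 1)) s"
    unfolding test_private_def
  proof (rule wp_for_to[where I = "\<lambda>k s'.
      s' ''g'' 0 = of_bool (\<forall>q<k. J (s ''w'' q) (s ''L'' q) \<and> cnt (s ''w'') x (s ''L'' q) = 1)"], goal_cases)
    case (7 k s')
    then have fr: "s' ''w'' = s ''w''" "s' ''L'' = s ''L''" "s' ''c'' = s ''c''" "s' ''n'' = s ''n''"
      and st: "loaded s'"
      using assms(1) by (auto simp: unchanged_def loaded_def)
    have i: "s' ''inc'' (s ''w'' k * n + s' ''p'' (s ''L'' k)) = of_bool (J (s ''w'' k) (s ''L'' k))"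
      using st assms 7 by (simp add: loadedD)
    have "cnt (s ''w'') x (s ''L'' k) \<ge> of_bool (J (s ''w'' k) (s ''L'' k))"
      unfolding cnt_def using 7(4)
      by (intro member_le_sum[where f = "\<lambda>q. of_bool (J (s ''w'' q) (s ''L'' k))"]) auto
    moreover have "s ''c'' (s ''L'' k) = cnt (s ''w'') x (s ''L'' k)" using assms 7 by simp
    moreover have "1 \<le> B" using B_ge by simp
    ultimately show ?case
      using 7 fr i st assms by (auto simp: inc_exp_def loadedD less_Suc_eq)
  qed (use assms B_ge in \<open>auto simp: loadedD\<close>)
  then show ?thesis by (rule wp_mono) auto
qed

lemma wp_test_edge:
  assumes "loaded s" "s ''i'' 0 = i" "i \<le> n" "s ''e'' 0 = e" "e < m" "s ''h'' 0 = 0"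
    "\<forall>u<i. s ''a'' u \<le> 1"
  shows "wp B test_edge
    (\<lambda>t s'. t \<le> n * 7 + 4 \<and>
       (s' ''h'' 0 \<noteq> 0 \<longleftrightarrow> (\<exists>v<n. J e v \<and> (if v < i then s ''a'' v \<noteq> 0 else s ''c'' v = 0)))) s"
proof -
  have "wp B test_edge (\<lambda>t s'. t \<le> n * (2 + 5) + 4 \<and> s' ''v'' 0 = n \<and> s' ''h'' 0 \<le> n \<and>
      (s' ''h'' 0 \<noteq> 0 \<longleftrightarrow> (\<exists>v<n. J e v \<and> (if v < i then s ''a'' v \<noteq> 0 else s ''c'' v = 0)))) s"
    unfolding test_edge_def
  proof (rule wp_for_to[where I = "\<lambda>k s'. s' ''h'' 0 \<le> k \<and>
      (s' ''h'' 0 \<noteq> 0 \<longleftrightarrow> (\<exists>v<k. J e v \<and> (if v < i then s ''a'' v \<noteq> 0 else s ''c'' v = 0)))"], goal_cases)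
    case (7 k s')
    then have fr: "s' ''a'' = s ''a''" "s' ''i'' = s ''i''" "s' ''c'' = s ''c''" "s' ''n'' = s ''n''"
        "s' ''e'' = s ''e''"
      and st: "loaded s'"
      using assms(1) by (auto simp: unchanged_def loaded_def)
    have i: "s' ''inc'' (e * n + s' ''p'' k) = of_bool (J e k)"
      using st assms 7 by (simp add: loadedD)
    define z where "z = (if k < i then s ''a'' k else 1 - s ''c'' k)"
    define P where "P v \<longleftrightarrow> J e v \<and> (if v < i then s ''a'' v \<noteq> 0 else s ''c'' v = 0)" for v
    have "z \<le> 1" and z: "z \<noteq> 0 \<longleftrightarrow> (if k < i then s ''a'' k \<noteq> 0 else s ''c'' k = 0)"
      using assms by (auto simp: z_def)
    have h: "s' ''h'' 0 \<le> k" "s' ''h'' 0 \<noteq> 0 \<longleftrightarrow> (\<exists>v<k. P v)" using 7(1) by (auto simp: P_def)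
    have "of_bool (J e k) * z \<le> 1" "of_bool (J e k) * z \<noteq> 0 \<longleftrightarrow> P k"
      using \<open>z \<le> 1\<close> z by (auto simp: P_def)
    then have "s' ''h'' 0 + of_bool (J e k) * z \<le> B \<and> s' ''h'' 0 + of_bool (J e k) * z \<le> Suc k \<and>
        (s' ''h'' 0 + of_bool (J e k) * z \<noteq> 0 \<longleftrightarrow> (\<exists>v<Suc k. P v))"
      using h B_ge 7(4) less_Suc_eq by auto
    then show ?case
      unfolding P_def[symmetric]
      using fr i st assms(1,2,4) 7(3) by (cases "k < i") (simp_all add: inc_exp_def loadedD z_def Suc_le_eq)
  qed (use assms B_ge in \<open>auto simp: loadedD\<close>)
  then show ?thesis by (rule wp_mono) auto
qed

definition hits_all :: "nat \<Rightarrow> (nat \<Rightarrow> nat) \<Rightarrow> (nat \<Rightarrow> nat) \<Rightarrow> bool" where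
  "hits_all i a c \<longleftrightarrow> (\<forall>e<m. \<exists>v<n. J e v \<and> (if v < i then a v \<noteq> 0 else c v = 0))"

lemma hits_all_cong: "(\<And>u. u < n \<Longrightarrow> c u = c' u) \<Longrightarrow> hits_all i a c = hits_all i a c'"
  by (simp add: hits_all_def cong: conj_cong)

lemma wp_test_edges:
  assumes "loaded s" "s ''i'' 0 = i" "i \<le> n" "s ''g'' 0 = of_bool P" "\<forall>u<i. s ''a'' u \<le> 1"
  shows "wp B test_edges
    (\<lambda>t s'. t \<le> m * (n * 7 + 14) + 4 \<and>
       s' ''g'' 0 = of_bool (P \<and> hits_all i (s ''a'') (s ''c''))) s"
proof -
  define hit where
    "hit e \<longleftrightarrow> (\<exists>v<n. J e v \<and> (if v < i then s ''a'' v \<noteq> 0 else s ''c'' v = 0))" for e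
  have "wp B test_edges (\<lambda>t s'. t \<le> m * ((n * 7 + 9) + 5) + 4 \<and> s' ''e'' 0 = m \<and>
     s' ''g'' 0 = of_bool (P \<and> (\<forall>e<m. hit e))) s"
    unfolding test_edges_def
  proof (rule wp_for_to[where I = "\<lambda>k s'. s' ''g'' 0 = of_bool (P \<and> (\<forall>e<k. hit e))"], goal_cases)
    case (7 k s')
    then have fr: "s' ''a'' = s ''a''" "s' ''i'' = s ''i''" "s' ''c'' = s ''c''" "s' ''n'' = s ''n''"
      and st: "loaded s'"
      using assms(1) by (auto simp: unchanged_def loaded_def)
    let ?s = "s'(''h'' := (s' ''h'')(0 := 0))"
    have st': "loaded ?s" using st by (simp add: loaded_def)
    have "wp B test_edge
      (\<lambda>t s''. t \<le> n * 7 + 4 \<and>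
       (s'' ''h'' 0 \<noteq> 0 \<longleftrightarrow> (\<exists>v<n. J k v \<and> (if v < i then ?s ''a'' v \<noteq> 0 else ?s ''c'' v = 0)))) ?s"
      using 7(3,4) fr assms(2,3,5) by (intro wp_test_edge[OF st']) simp_all
    then have "wp B test_edge (\<lambda>t. wp B (Cond (var ''h'') Skip (assign ''g'' (N 0)))
       (\<lambda>t' s''. 1 + (t + t' + 1) + 1 \<le> n * 7 + 9 \<and> (s''(''e'' := (s'' ''e'')(0 := Suc k))) ''g'' 0 =
         of_bool (P \<and> (\<forall>e<Suc k. hit e)))) ?s"
    proof (rule wp_conseq, goal_cases)
      case (1 t s'')
      then have "s'' ''g'' 0 = of_bool (P \<and> (\<forall>e<k. hit e))"
        using 7(1) by (simp add: unchanged_def)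
      moreover have "s'' ''h'' 0 \<noteq> 0 \<longleftrightarrow> hit k"
        using 1 fr by (simp add: hit_def)
      ultimately show ?case
        using 1(1) by (cases "hit k") (simp_all add: All_less_Suc)
    qed
    then show ?case by (simp del: wp_Cond)
  qed (use assms(1,4) B_ge in \<open>simp_all add: loadedD\<close>)
  then show ?thesis by (rule wp_mono) (simp add: hits_all_def hit_def algebra_simps)
qed

text \<open>That \<open>w q\<close> meets the chosen set only in \<open>L q\<close> is expressed by
  columns: no \<open>L q\<close> is counted by a second entry of \<open>w\<close>. Taken over all
  \<open>q\<close>, both say that \<open>w q\<close> contains \<open>L q'\<close> only for q' = q,
  and the column form needs just one counter per vertex.\<close>

definition good :: "nat \<Rightarrow> (nat \<Rightarrow> nat) \<Rightarrow> nat \<Rightarrow> (nat \<Rightarrow> nat) \<Rightarrow> (nat \<Rightarrow> nat) \<Rightarrow> bool" where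
  "good i a x L w \<longleftrightarrow> (\<forall>q<x. J (w q) (L q) \<and> cnt w x (L q) = 1) \<and> hits_all i a (cnt w x)"

lemma wp_check:
  assumes "loaded s" "s ''x'' 0 = x" "x \<le> n" "\<forall>q<x. s ''w'' q < m" "\<forall>q<x. s ''L'' q < n"
    "s ''i'' 0 = i" "i \<le> n" "\<forall>u<i. s ''a'' u \<le> 1"
  shows "wp B check
    (\<lambda>t s'. t \<le> 20 * ((n + 1) * (x + m + 1)) \<and>
       s' ''g'' 0 = of_bool (good i (s ''a'') x (s ''L'') (s ''w''))) s"
  unfolding check_def wp_Seq
proof (rule wp_conseq[OF wp_clear_counts[OF assms(1)]], goal_cases)
  case (1 t1 s1)
  then have fr1: "s1 ''x'' = s ''x''" "s1 ''w'' = s ''w''" "s1 ''L'' = s ''L''" "s1 ''i'' = s ''i''"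
      "s1 ''a'' = s ''a''" and st1: "loaded s1"
    using assms(1) by (auto simp: unchanged_def loaded_def)
  have "wp B count_all
    (\<lambda>t s'. t \<le> x * (n * 6 + 9) + 4 \<and> (\<forall>u<n. s' ''c'' u = cnt (s1 ''w'') x u)) s1"
    using st1 fr1 1 assms by (intro wp_count_all) auto
  then show ?case
  proof (rule wp_conseq, goal_cases)
    case (1 t2 s2)
    let ?s = "s2(''g'' := (s2 ''g'')(0 := 1))"
    from 1 have fr2: "?s ''x'' = s ''x''" "?s ''w'' = s ''w''" "?s ''L'' = s ''L''" "?s ''i'' = s ''i''"
        "?s ''a'' = s ''a''" and "loaded s2"
      using fr1 st1 by (auto simp: unchanged_def loaded_def)
    then have st2: "loaded ?s" by (simp add: loaded_def)
    have "wp B test_private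
      (\<lambda>t s'. t \<le> x * 6 + 4 \<and>
       s' ''g'' 0 = of_bool (\<forall>q<x. J (?s ''w'' q) (?s ''L'' q) \<and> cnt (?s ''w'') x (?s ''L'' q) = 1)) ?s"
      using fr1 fr2 1 assms by (intro wp_test_private[OF st2]) auto
    then have "wp B test_private (\<lambda>t3. wp B test_edges (\<lambda>t4 s'.
       t1 + (t2 + (1 + (t3 + t4 + 1) + 1) + 1) + 1 \<le> 20 * ((n + 1) * (x + m + 1)) \<and>
       s' ''g'' 0 = of_bool (good i (s ''a'') x (s ''L'') (s ''w'')))) ?s"
    proof (rule wp_conseq, goal_cases)
      case (1 t3 s3)
      then have fr3: "s3 ''x'' = s ''x''" "s3 ''w'' = s ''w''" "s3 ''L'' = s ''L''" "s3 ''i'' = s ''i''"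
        "s3 ''a'' = s ''a''" "s3 ''c'' = s2 ''c''" and st3: "loaded s3"
        using fr2 st2 by (auto simp: unchanged_def loaded_def)
      let ?P = "\<forall>q<x. J (s ''w'' q) (s ''L'' q) \<and> cnt (s ''w'') x (s ''L'' q) = 1"
      have "wp B test_edges (\<lambda>t s'. t \<le> m * (n * 7 + 14) + 4 \<and>
         s' ''g'' 0 = of_bool (?P \<and> hits_all i (s3 ''a'') (s3 ''c''))) s3"
        using st3 fr3 fr2 1 assms by (intro wp_test_edges) auto
      then show ?case
      proof (rule wp_conseq, goal_cases)
        case (1 t4 s4)
        have "hits_all i (s ''a'') (s2 ''c'') = hits_all i (s ''a'') (cnt (s ''w'') x)"
          using \<open>_ \<and> (\<forall>u<n. s2 ''c'' u = cnt (s1 ''w'') x u)\<close> fr1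
          by (intro hits_all_cong) auto
        moreover have "t1 + (t2 + (1 + (t3 + t4 + 1) + 1) + 1) + 1 \<le> 20 * ((n + 1) * (x + m + 1))"
        proof -
          have "t1 \<le> n * 6 + 4" "t2 \<le> x * (n * 6 + 9) + 4" "t3 \<le> x * 6 + 4" "t4 \<le> m * (n * 7 + 14) + 4"
            using 1 \<open>t1 \<le> _ \<and> _\<close> \<open>t2 \<le> _ \<and> _\<close> \<open>t3 \<le> _ \<and> _\<close> by auto
          moreover have "20 * ((n + 1) * (x + m + 1)) = 20 * n + 20 * (x * n) + 20 * (m * n) + 20 * x + 20 * m + 20"
            by (simp add: algebra_simps)
          moreover have "x * (n * 6 + 9) = 6 * (x * n) + 9 * x" "m * (n * 7 + 14) = 7 * (m * n) + 14 * m"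
            by (simp_all add: algebra_simps)
          \<comment> \<open>The additive constants sum to 21; the excess over 20 is absorbed by the
            terms with \<open>m\<close>, as \<open>m\<close> is positive.\<close>
          ultimately show ?thesis using m_pos by linarith
        qed
        ultimately show ?case
          using 1 fr3 by (simp add: good_def)
      qed
    qed
    then show ?case using B_ge by simp
  qed
qed

end

section \<open>The extension oracle\<close>

definition collect :: com where
  "collect = Seq (assign ''x'' (N 0)) (for_to ''j'' ''i''
     (Cond (Cell ''a'' (var ''j''))
       (Seq (Assign ''L'' (var ''x'') (var ''j''))
         (Seq (Assign ''w'' (var ''x'') (N 0)) (assign ''x'' (Plus (var ''x'') (N 1)))))
       Skip))"

text \<open>\<open>k\<close> has two roles: it stops the carry once a digit could be raised, and it
  tells \<open>search\<close> to continue. If the carry passes the last digit, \<open>k\<close>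
  remains 0 and the search ends; for \<open>x\<close> = 0 this happens right after the single empty
  choice.\<close>

definition increment :: com where
  "increment = Seq (assign ''j'' (N 0)) (Seq (assign ''k'' (N 0))
     (While (Times (Minus (var ''x'') (var ''j'')) (Minus (N 1) (var ''k'')))
       (Cond (Minus (var ''m'') (Plus (Cell ''w'' (var ''j'')) (N 1)))
         (Seq (Assign ''w'' (var ''j'') (Plus (Cell ''w'' (var ''j'')) (N 1))) (assign ''k'' (N 1)))
         (Seq (Assign ''w'' (var ''j'') (N 0)) (assign ''j'' (Plus (var ''j'') (N 1)))))))"

definition search :: com where
  "search = While (var ''k'')
     (Seq check (Cond (var ''g'') (Seq (assign ''f'' (N 1)) (assign ''k'' (N 0))) increment))"

definition extend :: com where
  "extend = Seq collect (Seq (assign ''f'' (N 0)) (Seq (assign ''k'' (N 1)) search))"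

lemma writes_extend[simp]:
  "writes collect = {''x'', ''j'', ''L'', ''w''}" "writes increment = {''j'', ''k'', ''w''}"
  "writes search = {''v'', ''c'', ''j'', ''g'', ''e'', ''h'', ''f'', ''k'', ''w''}"
  "writes extend = {''v'', ''c'', ''j'', ''g'', ''e'', ''h'', ''f'', ''k'', ''w'', ''x'', ''L''}"
  by (auto simp: collect_def increment_def search_def extend_def)

section \<open>Numbers in base \<open>b\<close>, least digit first\<close>

definition digits :: "nat \<Rightarrow> nat \<Rightarrow> (nat \<Rightarrow> nat) \<Rightarrow> bool" where
  "digits b x w \<longleftrightarrow> (\<forall>q<x. w q < b)"

text \<open>This value exists in the proof only. It orders the choices, so that progress of the
  odometer and exhaustion of all choices become arithmetical statements.\<close>

definition number :: "nat \<Rightarrow> nat \<Rightarrow> (nat \<Rightarrow> nat) \<Rightarrow> nat" where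
  "number b x w = (\<Sum>q<x. w q * b ^ q)"

lemma number_less: "digits b x w \<Longrightarrow> number b x w < b ^ x"
proof (induction x)
  case (Suc x)
  then have "number b x w < b ^ x" "w x < b" by (auto simp: digits_def)
  then have "number b (Suc x) w < b ^ x + w x * b ^ x" by (simp add: number_def)
  also have "\<dots> = Suc (w x) * b ^ x" by simp
  also have "\<dots> \<le> b * b ^ x" using \<open>w x < b\<close> by (intro mult_le_mono1) auto
  finally show ?case by simp
qed (simp add: number_def)

text \<open>The lower digits amount to less than b^x, so the top digit is the quotient by b^x and
  can be peeled off. The search is tracked by numbers whereas goodness depends on digits; this links
  the two.\<close>

lemma number_inj:
  assumes "digits b x w" "digits b x w'" "number b x w = number b x w'" "q < x"
  shows "w q = w' q"
  using assms
proof (induction x)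
  case (Suc x)
  have lt: "number b x w < b ^ x" "number b x w' < b ^ x"
    using Suc by (auto intro!: number_less simp: digits_def)
  have eq: "number b x w + w x * b ^ x = number b x w' + w' x * b ^ x"
    using Suc by (simp add: number_def)
  have "(number b x w + w x * b ^ x) div b ^ x = w x" "(number b x w' + w' x * b ^ x) div b ^ x = w' x"
    using lt div_mult_self1[of "b ^ x"] by (metis add.right_neutral div_less gr_implies_not0)+
  with eq have "w x = w' x" by simp
  moreover from this eq have "number b x w = number b x w'" by simp
  then have "w q = w' q" if "q < x" using Suc that by (auto simp: digits_def)
  ultimately show ?case using Suc by (cases "q = x") auto
qed simp

lemma number_upd: "j < x \<Longrightarrow> number b x (w(j := d)) + w j * b ^ j = number b x w + d * b ^ j"
proof -
  assume "j < x"
  then have "number b x u = u j * b ^ j + (\<Sum>q\<in>{..<x} - {j}. u q * b ^ q)" for u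
    unfolding number_def by (subst sum.remove[of _ j]) auto
  moreover have "(\<Sum>q\<in>{..<x} - {j}. (w(j := d)) q * b ^ q) = (\<Sum>q\<in>{..<x} - {j}. w q * b ^ q)"
    by (intro sum.cong) auto
  ultimately show ?thesis by simp
qed

context incidence
begin

lemma wp_collect:
  assumes "loaded s" "s ''i'' 0 = i" "i \<le> n"
  shows "wp B collect
    (\<lambda>t s'. t \<le> n * 11 + 6 \<and> s' ''x'' 0 = card {u. u < i \<and> s ''a'' u \<noteq> 0} \<and>
       s' ''L'' ` {..<s' ''x'' 0} = {u. u < i \<and> s ''a'' u \<noteq> 0} \<and> (\<forall>q<s' ''x'' 0. s' ''w'' q = 0)) s"
proof -
  let ?X = "\<lambda>k. {u. u < k \<and> s ''a'' u \<noteq> 0}"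
  let ?s = "s(''x'' := (s ''x'')(0 := 0))"
  have "wp B (for_to ''j'' ''i''
     (Cond (Cell ''a'' (var ''j''))
       (Seq (Assign ''L'' (var ''x'') (var ''j''))
         (Seq (Assign ''w'' (var ''x'') (N 0)) (assign ''x'' (Plus (var ''x'') (N 1)))))
       Skip)) (\<lambda>t s'. t \<le> i * (6 + 5) + 4 \<and> s' ''j'' 0 = i \<and>
        (s' ''x'' 0 = card (?X i) \<and> s' ''L'' ` {..<s' ''x'' 0} = ?X i \<and> (\<forall>q<s' ''x'' 0. s' ''w'' q = 0))) ?s"
  proof (rule wp_for_to[where I = "\<lambda>k s'. s' ''x'' 0 = card (?X k) \<and>
      s' ''L'' ` {..<s' ''x'' 0} = ?X k \<and> (\<forall>q<s' ''x'' 0. s' ''w'' q = 0)"], goal_cases)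
    case (7 k s')
    have fr: "s' ''a'' = s ''a''" using 7(2) by (simp add: unchanged_def)
    have fin: "finite (?X k)" by simp
    have le: "card (?X k) \<le> k" using card_mono[of "{..<k}" "?X k"] by auto
    have L: "s' ''L'' ` {..<card (?X k)} = ?X k" using 7(1) by metis
    have B: "k \<le> B" "card (?X k) < B" using le 7(4) assms(3) B_ge by auto
    show ?case
    proof (cases "s ''a'' k = 0")
      case True
      then have "?X (Suc k) = ?X k" using less_Suc_eq by auto
      then show ?thesis using True 7(1,3) L fr by simp
    next
      case False
      then have X': "{u. u < Suc k \<and> 0 < s ''a'' u} = insert k (?X k)" using less_Suc_eq by auto
      define c where "c = card (?X k)"
      have card: "card (insert k (?X k)) = Suc c" using fin by (simp add: c_def)
      have x: "s' ''x'' 0 = c" "\<forall>q<c. s' ''w'' q = 0" using 7(1) by (simp_all add: c_def)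
      have "(s' ''L'')(c := k) ` {..<Suc c} = insert k (s' ''L'' ` {..<c})"
        by (auto simp: lessThan_Suc)
      then have img: "(s' ''L'')(c := k) ` {..<Suc c} = insert k (?X k)"
        using L by (simp add: c_def)
      show ?thesis
        using 7(3) x False B[folded c_def] fr card img
        by (simp add: X' All_less_Suc del: fun_upd_image)
    qed
  qed (use assms B_ge in auto)
  then show ?thesis
    unfolding collect_def wp_Seq wp_Assign
    by (simp, elim wp_mono) (use assms(3) in auto)
qed

lemma wp_increment:
  assumes "loaded s" "s ''x'' 0 = x" "x \<le> n" "digits m x (s ''w'')"
  shows "wp B increment
    (\<lambda>t s'. t \<le> x * 7 + 6 \<and> digits m x (s' ''w'') \<and>
       (s' ''k'' 0 = 1 \<and> number m x (s' ''w'') = Suc (number m x (s ''w'')) \<or>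
        s' ''k'' 0 = 0 \<and> Suc (number m x (s ''w'')) = m ^ x)) s"
proof -
  let ?s = "s(''j'' := (s ''j'')(0 := 0), ''k'' := (s ''k'')(0 := 0))"
  let ?c = "Cond (Minus (var ''m'') (Plus (Cell ''w'' (var ''j'')) (N 1)))
         (Seq (Assign ''w'' (var ''j'') (Plus (Cell ''w'' (var ''j'')) (N 1))) (assign ''k'' (N 1)))
         (Seq (Assign ''w'' (var ''j'') (N 0)) (assign ''j'' (Plus (var ''j'') (N 1))))"
  let ?e = "Times (Minus (var ''x'') (var ''j'')) (Minus (N 1) (var ''k''))"
  \<comment> \<open>During the carry the digits below \<open>j\<close> have been reset to 0, and
    \<open>m ^ j\<close> is still owed to the incremented value.\<close>
  define I where "I c s' \<longleftrightarrow> s' ''j'' 0 \<le> x \<and> digits m x (s' ''w'') \<and>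
    (s' ''k'' 0 = 1 \<and> number m x (s' ''w'') = Suc (number m x (s ''w'')) \<or>
     s' ''k'' 0 = 0 \<and> x - s' ''j'' 0 \<le> c \<and>
       number m x (s' ''w'') + m ^ s' ''j'' 0 = Suc (number m x (s ''w'')))" for c s'
  have "wp B (While ?e ?c) (\<lambda>t s'. t \<le> x * (4 + 3) + 2 \<and> unchanged ?c ?s s' \<and> val ?e s' = 0 \<and>
      (\<exists>c\<le>x. I c s')) ?s"
  proof (rule wp_While)
    show "I x ?s" using assms by (simp add: I_def)
  next
    fix c s'
    assume I: "I c s'" and u: "unchanged ?c ?s s'" and e: "val ?e s' \<noteq> 0"
    have fr: "s' ''x'' = s ''x''" "s' ''m'' = s ''m''" using u by (simp_all add: unchanged_def)
    define j w where "j = s' ''j'' 0" and "w = s' ''w''"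
    have j: "j < x" and k: "s' ''k'' 0 = 0" and c: "x - j \<le> c"
      and num: "number m x w + m ^ j = Suc (number m x (s ''w''))" and d: "digits m x w"
      using I e fr assms(2) by (auto simp: I_def j_def w_def)
    have wj: "w j < m" using d j by (simp add: digits_def)
    have B: "Suc (w j) \<le> B" "j < B" using wj j assms(3) B_ge by simp_all
    show "0 < c \<and> wp B ?c (\<lambda>t s''. t \<le> 4 \<and> I (c - 1) s'') s'"
    proof (cases "Suc (w j) < m")
      case True
      have "digits m x (w(j := Suc (w j)))" using d True by (auto simp: digits_def)
      moreover have "number m x (w(j := Suc (w j))) = Suc (number m x (s ''w''))"
        using number_upd[OF j, of m w "Suc (w j)"] num by simp
      ultimately show ?thesis
        using True j c B fr assms(1) by (simp add: loadedD I_def flip: j_def w_def)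
    next
      case False
      have "digits m x (w(j := 0))" using d m_pos by (auto simp: digits_def)
      moreover have "number m x (w(j := 0)) + m ^ Suc j = Suc (number m x (s ''w''))"
      proof -
        have "w j = m - 1" using False wj by simp
        then have "m * m ^ j = w j * m ^ j + m ^ j" using m_pos by (simp add: mult_eq_if)
        then show ?thesis using number_upd[OF j, of m w 0] num by simp
      qed
      moreover have "0 < c" "x - Suc j \<le> c - Suc 0" using j c by linarith+
      ultimately show ?thesis
        using False j k B fr assms(1) by (simp add: loadedD I_def flip: j_def w_def)
    qed
  qed
  then have "wp B (While ?e ?c) (\<lambda>t s'. t + 4 \<le> x * 7 + 6 \<and> digits m x (s' ''w'') \<and>
       (s' ''k'' 0 = 1 \<and> number m x (s' ''w'') = Suc (number m x (s ''w'')) \<or>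
        s' ''k'' 0 = 0 \<and> Suc (number m x (s ''w'')) = m ^ x)) ?s"
  proof (rule wp_mono, goal_cases)
    case (1 t s')
    then obtain c where I: "I c s'" by blast
    have x: "s' ''x'' 0 = x" using 1 assms(2) by (simp add: unchanged_def)
    \<comment> \<open>Overflow means \<open>j\<close> = \<open>x\<close>, so m^x is still owed. As
      the old value lies below m^x, it must have been m^x - 1, the last choice.\<close>
    have lt: "number m x (s ''w'') < m ^ x" using assms(4) by (rule number_less)
    show ?case
    proof (cases "s' ''k'' 0 = 0")
      case True
      then have "s' ''j'' 0 = x" using 1 I x by (auto simp: I_def)
      then show ?thesis using True I 1 lt by (auto simp: I_def)
    next
      case False
      then show ?thesis using I 1 by (auto simp: I_def)
    qed
  qed
  then show ?thesis
    unfolding increment_def using B_ge by (simp add: eval_nat_numeral)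
qed

lemma good_cong:
  assumes "\<And>q. q < x \<Longrightarrow> w q = w' q"
  shows "good i a x L w = good i a x L w'"
proof -
  have "cnt w x v = cnt w' x v" for v using assms by (simp add: cnt_def)
  then have "cnt w x = cnt w' x" by blast
  then show ?thesis using assms by (simp add: good_def)
qed

lemma wp_search:
  assumes "loaded s" "s ''x'' 0 = x" "x \<le> n" "\<forall>q<x. s ''L'' q < n"
    "s ''i'' 0 = i" "i \<le> n" "\<forall>u<i. s ''a'' u \<le> 1"
    "s ''f'' 0 = 0" "s ''k'' 0 = 1" "\<forall>q<x. s ''w'' q = 0"
  shows "wp B search
    (\<lambda>t s'. t \<le> m ^ x * (20 * ((n + 1) * (x + m + 1)) + x * 7 + 11) + 2 \<and>
       s' ''f'' 0 = of_bool (\<exists>w. digits m x w \<and> good i (s ''a'') x (s ''L'') w)) s"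
proof -
  let ?c = "Seq check (Cond (var ''g'') (Seq (assign ''f'' (N 1)) (assign ''k'' (N 0))) increment)"
  let ?G = "good i (s ''a'') x (s ''L'')"
  \<comment> \<open>While \<open>k\<close> = 1, all choices with a smaller number have failed and
    the fuel covers those left; once \<open>k\<close> = 0, the answer in \<open>f\<close> is
    final.\<close>
  define I where "I c s' \<longleftrightarrow> digits m x (s' ''w'') \<and>
    (s' ''k'' 0 = 1 \<and> s' ''f'' 0 = 0 \<and> m ^ x - number m x (s' ''w'') \<le> c \<and>
       (\<forall>w. digits m x w \<longrightarrow> number m x w < number m x (s' ''w'') \<longrightarrow> \<not> ?G w) \<or>
     s' ''k'' 0 = 0 \<and> s' ''f'' 0 = of_bool (\<exists>w. digits m x w \<and> ?G w))" for c s'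
  have "wp B (While (var ''k'') ?c)
    (\<lambda>t s'. t \<le> m ^ x * ((20 * ((n + 1) * (x + m + 1)) + x * 7 + 8) + 3) + 2 \<and> unchanged ?c s s' \<and>
       val (var ''k'') s' = 0 \<and> (\<exists>c\<le>m ^ x. I c s')) s"
  proof (rule wp_While)
    show "I (m ^ x) s" using assms m_pos by (simp add: I_def digits_def number_def)
  next
    fix c s'
    assume I: "I c s'" and u: "unchanged ?c s s'" and e: "val (var ''k'') s' \<noteq> 0"
    have fr: "s' ''x'' = s ''x''" "s' ''L'' = s ''L''" "s' ''i'' = s ''i''" "s' ''a'' = s ''a''"
      and st: "loaded s'"
      using u assms(1) by (simp_all add: unchanged_def loaded_def)
    define w where "w = s' ''w''"
    have d: "digits m x w" and f: "s' ''f'' 0 = 0" and c: "m ^ x - number m x w \<le> c"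
      and bad: "\<And>u. digits m x u \<Longrightarrow> number m x u < number m x w \<Longrightarrow> \<not> ?G u"
      using I e by (auto simp: I_def w_def)
    have "0 < c" using number_less[OF d] c by simp
    moreover have "wp B check (\<lambda>t s''. t \<le> 20 * ((n + 1) * (x + m + 1)) \<and>
       s'' ''g'' 0 = of_bool (good i (s' ''a'') x (s' ''L'') (s' ''w''))) s'"
      using assms fr d by (intro wp_check[OF st]) (simp_all add: digits_def w_def)
    then have "wp B ?c (\<lambda>t s''. t \<le> 20 * ((n + 1) * (x + m + 1)) + x * 7 + 8 \<and> I (c - 1) s'') s'"
      unfolding wp_Seq
    proof (rule wp_conseq, goal_cases)
      case (1 t s1)
      then have fr1: "s1 ''x'' = s ''x''" "s1 ''w'' = w" "s1 ''f'' 0 = 0" "s1 ''k'' = s' ''k''"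
        and st1: "loaded s1"
        using fr st f by (simp_all add: unchanged_def loaded_def w_def)
      show ?case
      proof (cases "?G w")
        case True
        then have "\<exists>w. digits m x w \<and> ?G w" using d by blast
        then show ?thesis
          using 1(1) True B_ge fr fr1 d by (simp add: I_def flip: w_def)
      next
        case False
        then have g: "s1 ''g'' 0 = 0" using 1(1) fr by (simp add: w_def)
        have same: "?G u = ?G w" if "digits m x u" "number m x u = number m x w" for u
          using number_inj[OF that(1) d that(2)] by (rule good_cong)
        have bad': "\<not> ?G u" if "digits m x u" "number m x u \<le> number m x w" for u
          using bad[OF that(1)] same[OF that(1)] that(2) False by (cases "number m x u = number m x w") auto
        have "wp B increment (\<lambda>t s'. t \<le> x * 7 + 6 \<and> digits m x (s' ''w'') \<and>
           (s' ''k'' 0 = 1 \<and> number m x (s' ''w'') = Suc (number m x (s1 ''w'')) \<or>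
            s' ''k'' 0 = 0 \<and> Suc (number m x (s1 ''w'')) = m ^ x)) s1"
          using assms fr fr1 d by (intro wp_increment[OF st1]) simp_all
        then have "wp B increment (\<lambda>t' s'. t + (t' + 1) + 1 \<le> 20 * ((n + 1) * (x + m + 1)) + x * 7 + 8 \<and>
             I (c - 1) s') s1"
        proof (rule wp_conseq, goal_cases)
          case (1 t2 s2)
          have f2: "s2 ''f'' 0 = 0" using 1(2) fr1 by (simp add: unchanged_def)
          have "I (c - 1) s2"
          proof (cases "s2 ''k'' 0 = 0")
            case True
            have "\<not> ?G u" if "digits m x u" for u
              using number_less[OF that] bad'[OF that] 1(1) True fr1 by auto
            then have "\<not> (\<exists>u. digits m x u \<and> ?G u)" by blast
            then show ?thesis using True 1(1) f2 by (simp add: I_def)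
          next
            case False
            then show ?thesis using 1(1) f2 fr1 bad' c by (simp add: I_def less_Suc_eq_le)
          qed
          then show ?case using 1(1) \<open>t \<le> _ \<and> _\<close> by simp
        qed
        then show ?thesis using g by simp
      qed
    qed
    ultimately show "0 < c \<and>
      wp B ?c (\<lambda>t s''. t \<le> 20 * ((n + 1) * (x + m + 1)) + x * 7 + 8 \<and> I (c - 1) s'') s'"
      by blast
  qed
  then show ?thesis
    unfolding search_def by (rule wp_mono) (auto simp: I_def algebra_simps)
qed

text \<open>The listing \<open>L\<close> stays existential because the outcome will turn out to
  depend only on the set listed.\<close>

lemma wp_extend_good:
  assumes "loaded s" "s ''i'' 0 = i" "i \<le> n" "\<forall>u<i. s ''a'' u \<le> 1"
  defines "X \<equiv> {u. u < i \<and> s ''a'' u \<noteq> 0}"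
  defines "x \<equiv> card X"
  shows "wp B extend (\<lambda>t s'. t \<le> 70 * ((n + 1) * (x + m + 1) * m ^ x) \<and>
    (\<exists>L. L ` {..<x} = X \<and>
      s' ''f'' 0 = of_bool (\<exists>w. digits m x w \<and> good i (s ''a'') x L w))) s"
  unfolding extend_def wp_Seq[of _ collect]
proof (rule wp_conseq[OF wp_collect[OF assms(1-3)]], goal_cases)
  case (1 t1 s1)
  have x: "s1 ''x'' 0 = x" and "s1 ''L'' ` {..<s1 ''x'' 0} = X" and "\<forall>q<s1 ''x'' 0. s1 ''w'' q = 0"
    using 1(1) unfolding x_def X_def by blast+
  then have L: "s1 ''L'' ` {..<x} = X" and w: "\<forall>q<x. s1 ''w'' q = 0"
    by simp_all
  let ?s = "s1(''f'' := (s1 ''f'')(0 := 0), ''k'' := (s1 ''k'')(0 := 1))"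
  have st: "loaded ?s" and fr: "s1 ''i'' 0 = i" "s1 ''a'' = s ''a''"
    using assms(1,2) 1(2) by (simp_all add: unchanged_def loaded_def)
  have "x \<le> card {..<i}" unfolding x_def X_def by (intro card_mono) auto
  then have "x \<le> n" using assms(3) by simp
  have Ln: "\<forall>q<x. s1 ''L'' q < n"
  proof (intro allI impI)
    fix q assume "q < x"
    then have "s1 ''L'' q \<in> X" using L by blast
    then show "s1 ''L'' q < n" using assms(3) by (simp add: X_def)
  qed
  have *: "wp B search
    (\<lambda>t s'. t \<le> m ^ x * (20 * ((n + 1) * (x + m + 1)) + x * 7 + 11) + 2 \<and>
       s' ''f'' 0 = of_bool (\<exists>w. digits m x w \<and> good i (?s ''a'') x (?s ''L'') w)) ?s"
    using assms(3,4) \<open>x \<le> n\<close> Ln x w fr by (intro wp_search[OF st]) simp_all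
  have "t1 + (1 + (1 + t + 1) + 1) + 1 \<le> 70 * ((n + 1) * (x + m + 1) * m ^ x)"
    if "t \<le> m ^ x * (20 * ((n + 1) * (x + m + 1)) + x * 7 + 11) + 2" for t
  proof -
    let ?u = "(n + 1) * (x + m + 1)"
    have u: "x \<le> ?u" "n + 1 \<le> ?u" by simp_all
    have "1 \<le> m ^ x" using m_pos by simp
    then have "?u * 1 \<le> ?u * m ^ x" by (intro mult_le_mono2)
    \<comment> \<open>38 = 20 + 7 + 11, since \<open>x\<close> and 1 are at most \<open>?u\<close>;
      the margin up to 70 pays for \<open>collect\<close> and the fixed steps.\<close>
    moreover have "m ^ x * (20 * ?u + x * 7 + 11) \<le> m ^ x * (38 * ?u)"
      using u by (intro mult_le_mono2) linarith
    moreover have "m ^ x * (38 * ?u) = 38 * (?u * m ^ x)" by (simp only: mult_ac)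
    ultimately show ?thesis using that 1(1) u by linarith
  qed
  then have "wp B search (\<lambda>t s'. t1 + (1 + (1 + t + 1) + 1) + 1 \<le> 70 * ((n + 1) * (x + m + 1) * m ^ x) \<and>
      (\<exists>L. L ` {..<x} = X \<and>
        s' ''f'' 0 = of_bool (\<exists>w. digits m x w \<and> good i (s ''a'') x L w))) ?s"
    using L fr by (intro wp_mono[OF *] conjI exI[of _ "s1 ''L''"]) auto
  then show ?case
    using B_ge by (simp add: numeral_2_eq_2)
qed

end

section \<open>Extendible sets of vertices\<close>

lemma minimal_hitting_setD:
  assumes "minimal_hitting_set V H T"
  shows "T \<subseteq> V" "E \<in> H \<Longrightarrow> T \<inter> E \<noteq> {}"
  using assms by (simp_all add: minimal_hitting_set_def hitting_set_def)

text \<open>Without \<open>x\<close> the set misses some edge, and since it did hit that edge, it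
  did so in \<open>x\<close> alone.\<close>

lemma minimal_hitting_set_private:
  assumes "minimal_hitting_set V H T" "x \<in> T"
  obtains E where "E \<in> H" "T \<inter> E = {x}"
proof -
  have "T - {x} \<subset> T" using assms(2) by blast
  then have "\<not> hitting_set V H (T - {x})" and T: "hitting_set V H T"
    using assms(1) unfolding minimal_hitting_set_def by blast+
  moreover have "T - {x} \<subseteq> V" using T by (auto simp: hitting_set_def)
  ultimately obtain E where "E \<in> H" "(T - {x}) \<inter> E = {}" unfolding hitting_set_def by blast
  moreover have "T \<inter> E \<noteq> {}" using T \<open>E \<in> H\<close> by (simp add: hitting_set_def)
  ultimately have "T \<inter> E = {x}" by blast
  with \<open>E \<in> H\<close> show ?thesis by (rule that)
qed

lemma hitting_set_contains_minimal:
  assumes "finite V" "hitting_set V H Z"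
  obtains T where "T \<subseteq> Z" "minimal_hitting_set V H T"
proof -
  have "Z \<subseteq> V" using assms(2) unfolding hitting_set_def by (rule conjunct1)
  then have "finite Z" using assms(1) by (rule finite_subset)
  then have "hitting_set V H Z \<Longrightarrow> \<exists>T\<subseteq>Z. minimal_hitting_set V H T"
  proof (induction Z rule: finite_psubset_induct)
    case (psubset Z)
    show ?case
    proof (cases "\<exists>Z'. Z' \<subset> Z \<and> hitting_set V H Z'")
      case True
      then obtain Z' where Z': "Z' \<subset> Z" "hitting_set V H Z'" by (elim exE conjE)
      from psubset.IH[OF this] obtain T where "T \<subseteq> Z'" "minimal_hitting_set V H T" by (elim exE conjE)
      with Z'(1) show ?thesis by (intro exI[of _ T]) simp
    next
      case False
      with psubset.prems have "minimal_hitting_set V H Z" unfolding minimal_hitting_set_def by (rule conjI)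
      then show ?thesis by (intro exI[of _ Z]) simp
    qed
  qed
  from this[OF assms(2)] show ?thesis using that by (elim exE conjE)
qed

text \<open>Private edges of different vertices differ, so picking one for each vertex is
  injective.\<close>

lemma card_minimal_hitting_set_le:
  assumes "minimal_hitting_set V H T" "finite H"
  shows "card T \<le> card H"
proof -
  have "\<forall>x\<in>T. \<exists>E. E \<in> H \<and> T \<inter> E = {x}"
  proof
    fix x assume "x \<in> T"
    then obtain E where "E \<in> H" "T \<inter> E = {x}" by (rule minimal_hitting_set_private[OF assms(1)])
    then show "\<exists>E. E \<in> H \<and> T \<inter> E = {x}" by blast
  qed
  then obtain E where E: "\<forall>x\<in>T. E x \<in> H \<and> T \<inter> E x = {x}" by metis
  then have "inj_on E T" by (intro inj_onI) (metis singleton_inject)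
  moreover have "E ` T \<subseteq> H" using E by blast
  ultimately show ?thesis using assms(2) by (rule card_inj_on_le)
qed

section \<open>Transversals and the extendibility criterion\<close>

context incidence
begin

definition edges :: "nat set set" where
  "edges = (\<lambda>e. {v. v < n \<and> J e v}) ` {..<m}"

definition transversals :: "nat set set" where
  "transversals = Tr {..<n} edges"

lemma transversals_subset: "T \<in> transversals \<Longrightarrow> T \<subseteq> {..<n}"
  by (simp add: transversals_def Tr_def minimal_hitting_setD)

lemma finite_transversals: "finite transversals"
  by (rule finite_subset[of _ "Pow {..<n}"]) (simp_all add: transversals_subset subsetI)

lemma card_transversal_le: "T \<in> transversals \<Longrightarrow> card T \<le> m"
proof -
  assume "T \<in> transversals"
  then have "card T \<le> card edges"
    by (simp add: transversals_def Tr_def edges_def card_minimal_hitting_set_le)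
  also have "\<dots> \<le> card {..<m}" unfolding edges_def by (intro card_image_le) simp
  finally show ?thesis by simp
qed

definition pref :: "nat \<Rightarrow> (nat \<Rightarrow> nat) \<Rightarrow> nat set" where
  "pref i a = {u. u < i \<and> a u \<noteq> 0}"

lemma cnt_card: "cnt w x v = card {q. q < x \<and> J (w q) v}"
proof -
  have "cnt w x v = card ({..<x} \<inter> {q. J (w q) v})"
    by (simp add: cnt_def)
  also have "{..<x} \<inter> {q. J (w q) v} = {q. q < x \<and> J (w q) v}" by blast
  finally show ?thesis .
qed

lemma cnt_eq_0: "cnt w x v = 0 \<longleftrightarrow> (\<forall>q<x. \<not> J (w q) v)"
  by (auto simp: cnt_card)

lemma cnt_eq_1:
  assumes "q < x" "J (w q) v"
  shows "cnt w x v = 1 \<longleftrightarrow> (\<forall>q'<x. J (w q') v \<longrightarrow> q' = q)"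
proof -
  let ?Q = "{q. q < x \<and> J (w q) v}"
  have "q \<in> ?Q" using assms by simp
  have "card ?Q = 1 \<longleftrightarrow> ?Q = {q}"
  proof
    assume "card ?Q = 1"
    then obtain y where "?Q = {y}" by (rule card_1_singletonE)
    with \<open>q \<in> ?Q\<close> show "?Q = {q}" by simp
  qed simp
  also have "\<dots> \<longleftrightarrow> (\<forall>q'\<in>?Q. q' = q)" using \<open>q \<in> ?Q\<close> by blast
  finally show ?thesis by (simp add: cnt_card imp_conjL)
qed

text \<open>A set \<open>X\<close> of vertices below \<open>i\<close> extends to a transversal without other vertices below \<open>i\<close> iff
  every vertex of \<open>X\<close> can be given an edge meeting \<open>X\<close> only there, such that the vertices from \<open>i\<close> on
  that lie in none of these edges hit all edges not met by \<open>X\<close>: any minimal hitting set inside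
  the resulting set has to keep \<open>X\<close>.\<close>

lemma good_iff_extendible:
  assumes "i \<le> n" "L ` {..<x} = pref i a" "x = card (pref i a)"
  shows "(\<exists>w. digits m x w \<and> good i a x L w) \<longleftrightarrow> (\<exists>T\<in>transversals. T \<inter> {..<i} = pref i a)"
proof
  assume "\<exists>w. digits m x w \<and> good i a x L w"
  then obtain w where "digits m x w" "good i a x L w" by (elim exE conjE)
  then have d: "\<And>q. q < x \<Longrightarrow> w q < m"
    and w: "\<And>q. q < x \<Longrightarrow> J (w q) (L q)" "\<And>q. q < x \<Longrightarrow> cnt w x (L q) = 1"
    and hits: "\<And>e. e < m \<Longrightarrow> \<exists>v<n. J e v \<and> (if v < i then a v \<noteq> 0 else cnt w x v = 0)"
    by (simp_all add: digits_def good_def hits_all_def)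
  define Z where "Z = pref i a \<union> {v. i \<le> v \<and> v < n \<and> cnt w x v = 0}"
  have Z: "v \<in> Z \<longleftrightarrow> v < n \<and> (if v < i then a v \<noteq> 0 else cnt w x v = 0)" for v
    using assms(1) by (cases "v < i") (simp_all add: Z_def pref_def)
  have "hitting_set {..<n} edges Z"
    unfolding hitting_set_def edges_def
  proof (intro conjI ballI)
    show "Z \<subseteq> {..<n}" using Z by (intro subsetI) simp
  next
    fix E assume "E \<in> (\<lambda>e. {v. v < n \<and> J e v}) ` {..<m}"
    then obtain e where e: "e < m" "E = {v. v < n \<and> J e v}" by (elim imageE) simp
    from hits[OF e(1)] obtain v where "v < n" "J e v" "if v < i then a v \<noteq> 0 else cnt w x v = 0"
      by (elim exE conjE)
    then have "v \<in> Z \<inter> E" using e(2) Z[of v] by simp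
    then show "Z \<inter> E \<noteq> {}" by blast
  qed
  then obtain T where T: "T \<subseteq> Z" "minimal_hitting_set {..<n} edges T"
    by (rule hitting_set_contains_minimal[OF finite_lessThan])
  \<comment> \<open>Let u = \<open>L q\<close>. The set \<open>T\<close> meets the edge
    \<open>w q\<close> in some \<open>v\<close>. Being counted, \<open>v\<close> is not among the
    later vertices of \<open>Z\<close>, so it is a chosen vertex \<open>L q'\<close>, and its count
    1 leaves only q' = q.\<close>
  have "u \<in> T" if "u \<in> pref i a" for u
  proof -
    have "u \<in> L ` {..<x}" using that assms(2) by simp
    then obtain q where q: "q < x" "u = L q" by (elim imageE) simp
    have "T \<inter> {v. v < n \<and> J (w q) v} \<noteq> {}"
      using d[OF q(1)] by (intro minimal_hitting_setD(2)[OF T(2)]) (simp add: edges_def)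
    then obtain v where v: "v \<in> T" "J (w q) v" by blast
    have "cnt w x v \<noteq> 0"
    proof
      assume "cnt w x v = 0"
      then have "\<forall>q<x. \<not> J (w q) v" by (simp add: cnt_eq_0)
      then show False using q(1) v(2) by simp
    qed
    moreover have "v \<in> Z" using T(1) v(1) by (rule subsetD)
    ultimately have "v \<in> L ` {..<x}" using assms(2) by (simp add: Z_def)
    then obtain q' where q': "q' < x" "v = L q'" by (elim imageE) simp
    have "q = q'"
      using cnt_eq_1[of q' x w v] w[OF q'(1)] q' q(1) v(2) by simp
    then show ?thesis using v(1) q q' by simp
  qed
  moreover have "T \<inter> {..<i} \<subseteq> pref i a" using T(1) unfolding Z_def by auto
  moreover have "pref i a \<subseteq> {..<i}" by (auto simp: pref_def)
  ultimately have "T \<inter> {..<i} = pref i a" by blast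
  moreover have "T \<in> transversals" using T(2) by (simp add: transversals_def Tr_def)
  ultimately show "\<exists>T\<in>transversals. T \<inter> {..<i} = pref i a" by blast
next
  assume "\<exists>T\<in>transversals. T \<inter> {..<i} = pref i a"
  then obtain T where "T \<in> transversals" and T2: "T \<inter> {..<i} = pref i a" by blast
  then have T: "minimal_hitting_set {..<n} edges T" by (simp add: transversals_def Tr_def)
  \<comment> \<open>\<open>L\<close> has as many indices as values, hence lists without repetition;
    this later yields q' = q from equal vertices.\<close>
  have "card (L ` {..<x}) = card {..<x}" using assms(2,3) by simp
  then have inj: "inj_on L {..<x}" by (rule eq_card_imp_inj_on[OF finite_lessThan])
  have LT: "L q \<in> T" "L q < i" if "q < x" for q
  proof -
    have "L q \<in> L ` {..<x}" using that by simp
    then have "L q \<in> T \<inter> {..<i}" using assms(2) T2 by simp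
    then show "L q \<in> T" "L q < i" by simp_all
  qed
  have "\<forall>q. \<exists>e. q < x \<longrightarrow> e < m \<and> T \<inter> {v. v < n \<and> J e v} = {L q}"
  proof
    fix q
    show "\<exists>e. q < x \<longrightarrow> e < m \<and> T \<inter> {v. v < n \<and> J e v} = {L q}"
    proof (cases "q < x")
      case True
      obtain E where "E \<in> edges" "T \<inter> E = {L q}"
        by (rule minimal_hitting_set_private[OF T LT(1)[OF True]])
      then show ?thesis unfolding edges_def by (elim imageE) (simp, blast)
    qed simp
  qed
  then obtain w where w: "\<forall>q. q < x \<longrightarrow> w q < m \<and> T \<inter> {v. v < n \<and> J (w q) v} = {L q}"
    by (elim choice[THEN exE])
  have J: "J (w q) v \<longleftrightarrow> v = L q" if "v \<in> T" "q < x" for v q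
  proof -
    have "v < n" using minimal_hitting_setD(1)[OF T] that(1) by blast
    then have "J (w q) v \<longleftrightarrow> v \<in> T \<inter> {v. v < n \<and> J (w q) v}" using that(1) by simp
    then show ?thesis using w that(2) by simp
  qed
  have JL: "J (w q) (L q)" "cnt w x (L q) = 1" if "q < x" for q
  proof -
    show "J (w q) (L q)" using J[OF LT(1)[OF that] that] by simp
    moreover have "q' = q" if "q' < x" "J (w q') (L q)" for q'
      using J[OF LT(1)[OF \<open>q < x\<close>] that(1)] that inj \<open>q < x\<close> by (simp add: inj_on_eq_iff)
    ultimately show "cnt w x (L q) = 1" using cnt_eq_1[OF \<open>q < x\<close>] by blast
  qed
  \<comment> \<open>Any vertex of \<open>T\<close> in the edge is a witness: below \<open>i\<close>
    it belongs to the node, and from \<open>i\<close> on it avoids all edges \<open>w q\<close>,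
    since these meet \<open>T\<close> only in vertices below \<open>i\<close>.\<close>
  have "\<exists>v<n. J e v \<and> (if v < i then a v \<noteq> 0 else cnt w x v = 0)" if "e < m" for e
  proof -
    have "T \<inter> {v. v < n \<and> J e v} \<noteq> {}"
      using that by (intro minimal_hitting_setD(2)[OF T]) (simp add: edges_def)
    then obtain v where v: "v \<in> T" "v < n" "J e v" by blast
    have "if v < i then a v \<noteq> 0 else cnt w x v = 0"
    proof (cases "v < i")
      case True
      then have "v \<in> pref i a" using v(1) T2 by blast
      then show ?thesis using True by (simp add: pref_def)
    next
      case False
      have "\<not> J (w q) v" if "q < x" for q
        using J[OF v(1) that] LT(2)[OF that] False by (cases "v = L q") simp_all
      then show ?thesis using False by (simp add: cnt_eq_0)
    qed
    then show ?thesis using v by (intro exI[of _ v] conjI)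
  qed
  then have "good i a x L w" using JL by (simp add: good_def hits_all_def)
  moreover have "digits m x w" using w by (simp add: digits_def)
  ultimately show "\<exists>w. digits m x w \<and> good i a x L w" by blast
qed

text \<open>While the array \<open>a\<close> describes the current node of the search tree at depth \<open>i\<close>, the transversals
  still to be printed are those below the node, \<open>below i a\<close>, and those branching off to the right of
  the path to it, \<open>after i a\<close>.\<close>

definition below :: "nat \<Rightarrow> (nat \<Rightarrow> nat) \<Rightarrow> nat set set" where
  "below i a = {T \<in> transversals. T \<inter> {..<i} = pref i a}"

definition after :: "nat \<Rightarrow> (nat \<Rightarrow> nat) \<Rightarrow> nat set set" where
  "after i a = {T \<in> transversals. \<exists>j<i. T \<inter> {..<j} = pref j a \<and> a j \<noteq> 0 \<and> j \<notin> T}"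

lemma pref_cong: "(\<And>u. u < i \<Longrightarrow> a u = a' u) \<Longrightarrow> pref i a = pref i a'"
  by (auto simp: pref_def)

lemma below_cong: "(\<And>u. u < i \<Longrightarrow> a u = a' u) \<Longrightarrow> below i a = below i a'"
  by (simp add: below_def cong: pref_cong)

lemma after_cong:
  assumes "\<And>u. u < i \<Longrightarrow> a u = a' u"
  shows "after i a = after i a'"
proof -
  have "pref j a = pref j a'" if "j < i" for j using assms that by (intro pref_cong) auto
  then show ?thesis using assms by (simp add: after_def cong: conj_cong)
qed

lemma below_Suc: "below (Suc i) a = {T \<in> below i a. i \<in> T \<longleftrightarrow> a i \<noteq> 0}"
proof -
  have "T \<inter> {..<Suc i} = pref (Suc i) a \<longleftrightarrow> T \<inter> {..<i} = pref i a \<and> (i \<in> T \<longleftrightarrow> a i \<noteq> 0)" for T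
  proof -
    have "T \<inter> {..<Suc i} = (if i \<in> T then insert i (T \<inter> {..<i}) else T \<inter> {..<i})"
      by (auto simp: less_Suc_eq)
    moreover have "pref (Suc i) a = (if a i \<noteq> 0 then insert i (pref i a) else pref i a)"
      by (auto simp: pref_def less_Suc_eq)
    moreover have "i \<notin> T \<inter> {..<i}" "i \<notin> pref i a" by (simp_all add: pref_def)
    ultimately show ?thesis by (cases "i \<in> T"; cases "a i = 0") (simp_all add: insert_ident, blast+)
  qed
  then show ?thesis by (simp add: below_def conj_assoc)
qed

lemma after_Suc: "after (Suc i) a = after i a \<union> (if a i \<noteq> 0 then {T \<in> below i a. i \<notin> T} else {})"
  by (rule set_eqI) (simp add: after_def below_def Ex_less_Suc, blast)

lemma below_0: "below 0 a = transversals"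
  by (auto simp: below_def pref_def)

lemma after_0: "after 0 a = {}"
  by (auto simp: after_def)

lemma below_n: "T \<in> below n a \<Longrightarrow> T = pref n a"
  using transversals_subset[of T] by (simp add: below_def Int_absorb2)

lemma below_n_not_after: "below n a \<inter> after n a = {}"
proof -
  have False if "T \<in> below n a" "T \<in> after n a" for T
  proof -
    from that(2) obtain j where "j < n" "a j \<noteq> 0" "j \<notin> T" unfolding after_def by blast
    then show False using below_n[OF that(1)] by (simp add: pref_def)
  qed
  then show ?thesis by blast
qed

text \<open>Entering the in-branch moves the transversals avoiding \<open>i\<close> from the subtree
  to the right of the path, so nothing is lost.\<close>

lemma branch_1:
  "below (Suc i) (a(i := 1)) \<union> after (Suc i) (a(i := 1)) = below i a \<union> after i a"
proof -
  have "below i (a(i := 1)) = below i a" "after i (a(i := 1)) = after i a"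
    by (intro below_cong after_cong; simp)+
  then show ?thesis by (auto simp: below_Suc after_Suc)
qed

text \<open>If the in-branch is empty, no transversal below the node contains \<open>i\<close>, so
  the out-branch inherits them all. That is why \<open>descend\<close> tests one child only.\<close>

lemma branch_0:
  assumes "below (Suc i) (a(i := 1)) = {}"
  shows "below (Suc i) (a(i := 0)) = below i a" "after (Suc i) (a(i := 0)) = after i a"
proof -
  have "below i (a(i := d)) = below i a" "after i (a(i := d)) = after i a" for d
    by (intro below_cong after_cong; simp)+
  then show "below (Suc i) (a(i := 0)) = below i a" "after (Suc i) (a(i := 0)) = after i a"
    using assms by (auto simp: below_Suc after_Suc)
qed

text \<open>On return from the in-branch, the sets to its right split into those of the out-branch
  and those to the right of the parent.\<close>

lemma turn:
  assumes "a i \<noteq> 0"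
  shows "below (Suc i) (a(i := 0)) \<union> after (Suc i) (a(i := 0)) = after (Suc i) a"
    "after (Suc i) (a(i := 0)) = after i a"
proof -
  have "below i (a(i := 0)) = below i a" "after i (a(i := 0)) = after i a"
    by (intro below_cong after_cong; simp)+
  then show "below (Suc i) (a(i := 0)) \<union> after (Suc i) (a(i := 0)) = after (Suc i) a"
    "after (Suc i) (a(i := 0)) = after i a"
    using assms by (auto simp: below_Suc after_Suc)
qed

text \<open>From |X| <= m + 1 and m >= 1 follows |X| + m + 1 <= 4 m, which turns 70 into 280 and
  supplies one factor m; the number of choices contributes m^(k + 1).\<close>

lemma wp_extend:
  assumes "loaded s" "s ''i'' 0 = i" "i \<le> n" "\<forall>u<i. s ''a'' u \<le> 1"
    and k: "\<And>T. T \<in> transversals \<Longrightarrow> card T \<le> k"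
    and small: "card (pref i (s ''a'')) \<le> Suc k" "card (pref i (s ''a'')) \<le> Suc m"
  shows "wp B extend (\<lambda>t s'. t \<le> 280 * ((n + 1) * m ^ (k + 2)) \<and>
    s' ''f'' 0 = of_bool (below i (s ''a'') \<noteq> {})) s"
proof (rule wp_mono[OF wp_extend_good[OF assms(1-4), folded pref_def]], goal_cases)
  case (1 t s')
  let ?x = "card (pref i (s ''a''))"
  have "(n + 1) * (?x + m + 1) * m ^ ?x \<le> (n + 1) * (4 * m) * m ^ Suc k"
    using small m_pos by (intro mult_le_mono mult_le_mono2 power_increasing) auto
  also have "\<dots> = 4 * ((n + 1) * m ^ (k + 2))" by (simp add: algebra_simps)
  finally have "70 * ((n + 1) * (?x + m + 1) * m ^ ?x) \<le> 280 * ((n + 1) * m ^ (k + 2))" by linarith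
  moreover have "s' ''f'' 0 = of_bool (below i (s ''a'') \<noteq> {})"
  proof -
    from 1 obtain L where "L ` {..<?x} = pref i (s ''a'')"
      and f: "s' ''f'' 0 = of_bool (\<exists>w. digits m ?x w \<and> good i (s ''a'') ?x L w)"
      by (elim exE conjE)
    from good_iff_extendible[OF assms(3) this(1) refl]
    have "(\<exists>w. digits m ?x w \<and> good i (s ''a'') ?x L w) \<longleftrightarrow> below i (s ''a'') \<noteq> {}"
      by (simp add: below_def Bex_def)
    with f show ?thesis by (simp only:)
  qed
  ultimately show ?case using 1 by linarith
qed

end

section \<open>Walking through the search tree\<close>

definition descend :: com where
  "descend = While (Minus (var ''n'') (var ''i''))
     (Seq (Assign ''a'' (var ''i'') (N 1)) (Seq (assign ''i'' (Plus (var ''i'') (N 1)))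
       (Seq extend (Cond (var ''f'') Skip (Assign ''a'' (Minus (var ''i'') (N 1)) (N 0))))))"

definition print_loop :: com where
  "print_loop = While (Minus (var ''n'') (var ''j''))
     (Seq (Cond (Cell ''a'' (var ''j'')) (Write (Cell ''p'' (var ''j''))) Skip)
       (assign ''j'' (Plus (var ''j'') (N 1))))"

definition print_set :: com where
  "print_set = Seq (assign ''j'' (N 0)) (Seq print_loop Output)"

text \<open>Unlike in the descent, the out-branch must be tested here: the parent may be extendible
  only through the in-branch, which is exhausted. The loop ends with \<open>f\<close> = 0 only at
  the root, and this also ends \<open>enum_loop\<close>.\<close>

definition ascend :: com where
  "ascend = Seq (assign ''f'' (N 0)) (While (Times (var ''i'') (Minus (N 1) (var ''f'')))
     (Cond (Cell ''a'' (Minus (var ''i'') (N 1)))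
       (Seq (Assign ''a'' (Minus (var ''i'') (N 1)) (N 0))
         (Seq extend (Cond (var ''f'') Skip (assign ''i'' (Minus (var ''i'') (N 1))))))
       (assign ''i'' (Minus (var ''i'') (N 1)))))"

definition enum_loop :: com where
  "enum_loop = While (var ''f'') (Seq descend (Seq print_set ascend))"

lemma writes_enum_loop[simp]:
  "writes descend = {''i'', ''a''} \<union> writes extend" "writes print_loop = {''j''}"
  "writes print_set = {''j''}" "writes ascend = {''i'', ''a'', ''f''} \<union> writes extend"
  "writes enum_loop = {''i'', ''a''} \<union> writes extend"
  by (auto simp: descend_def print_loop_def print_set_def ascend_def enum_loop_def)

fun puts :: "event list \<Rightarrow> nat list" where
  "puts [] = []"
| "puts (Put k # ls) = k # puts ls"
| "puts (_ # ls) = puts ls"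

lemma puts_append[simp]: "puts (xs @ ys) = puts xs @ puts ys"
  by (induction xs rule: puts.induct) auto

lemma puts_ticks: "set xs \<subseteq> {Tick} \<Longrightarrow> puts xs = []"
  by (induction xs rule: puts.induct) auto

lemma outputs_from_append:
  "Flush \<notin> set xs \<Longrightarrow> outputs_from us (xs @ ys) = outputs_from (us @ puts xs) ys"
  by (induction us xs rule: outputs_from.induct) auto

lemma gaps_from_append: "Flush \<notin> set xs \<Longrightarrow> gaps_from t (xs @ ys) = gaps_from (t + length xs) ys"
  by (induction t xs rule: gaps_from.induct) auto

text \<open>The strict lexicographic order on sets of positions, free of \<open>first\<close>:
  \<open>j\<close> is the least element of the symmetric difference.\<close>

definition lex_before :: "nat set \<Rightarrow> nat set \<Rightarrow> bool" where
  "lex_before S T \<longleftrightarrow> (\<exists>j. j \<in> S \<and> j \<notin> T \<and> S \<inter> {..<j} = T \<inter> {..<j})"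

section \<open>Descent and ascent with their running times\<close>

context incidence
begin

lemma card_transversal_le_hrank: "T \<in> transversals \<Longrightarrow> card T \<le> hrank transversals"
  unfolding hrank_def using finite_transversals by (auto intro!: Max_ge)

lemma card_pref_le:
  assumes "below i a \<noteq> {}"
  shows "card (pref (Suc i) a) \<le> Suc (hrank transversals)" "card (pref (Suc i) a) \<le> Suc m"
proof -
  obtain T where T: "T \<in> transversals" "T \<inter> {..<i} = pref i a"
    using assms by (auto simp: below_def)
  have "finite T" using transversals_subset[OF T(1)] by (rule finite_subset) simp
  have "pref (Suc i) a \<subseteq> insert i (pref i a)" by (auto simp: pref_def less_Suc_eq)
  also have "\<dots> \<subseteq> insert i T" using T(2) by blast
  finally have "card (pref (Suc i) a) \<le> card (insert i T)" using \<open>finite T\<close> by (intro card_mono) simp_all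
  also have "\<dots> \<le> Suc (card T)" by (rule card_insert_le_m1) simp_all
  finally have *: "card (pref (Suc i) a) \<le> Suc (card T)" .
  show "card (pref (Suc i) a) \<le> Suc (hrank transversals)"
    using * card_transversal_le_hrank[OF T(1)] by linarith
  show "card (pref (Suc i) a) \<le> Suc m" using * card_transversal_le[OF T(1)] by linarith
qed

definition extend_time :: nat where
  "extend_time = 280 * ((n + 1) * m ^ (hrank transversals + 2))"

lemma wp_extend':
  assumes "loaded s" "s ''i'' 0 = Suc i" "i < n" "\<forall>u\<le>i. s ''a'' u \<le> 1" "below i (s ''a'') \<noteq> {}"
  shows "wp B extend (\<lambda>t s'. t \<le> extend_time \<and>
    s' ''f'' 0 = of_bool (below (Suc i) (s ''a'') \<noteq> {})) s"
  unfolding extend_time_def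
  using assms card_pref_le[OF assms(5)]
  by (intro wp_extend[OF assms(1)]) (simp_all add: card_transversal_le_hrank less_Suc_eq_le)

text \<open>Nonemptiness of \<open>below\<close> has two uses: it bounds the size of the children to
  be tested, and it ensures that every descent ends in an output.\<close>

definition node :: "store \<Rightarrow> bool" where
  "node s \<longleftrightarrow> loaded s \<and> s ''i'' 0 \<le> n \<and> (\<forall>u<s ''i'' 0. s ''a'' u \<le> 1) \<and>
     below (s ''i'' 0) (s ''a'') \<noteq> {}"

definition remaining :: "store \<Rightarrow> nat set set" where
  "remaining s = below (s ''i'' 0) (s ''a'') \<union> after (s ''i'' 0) (s ''a'')"

lemma wp_descend:
  assumes "node s"
  shows "wp B descend (\<lambda>t s'. t \<le> n * (extend_time + 10) + 2 \<and> node s' \<and> s' ''i'' 0 = n \<and>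
    remaining s' = remaining s) s"
proof -
  let ?r = "Cond (var ''f'') Skip (Assign ''a'' (Minus (var ''i'') (N 1)) (N 0))"
  let ?c = "Seq (Assign ''a'' (var ''i'') (N 1)) (Seq (assign ''i'' (Plus (var ''i'') (N 1)))
       (Seq extend ?r))"
  let ?e = "Minus (var ''n'') (var ''i'')"
  define I where "I c s' \<longleftrightarrow> node s' \<and> s' ''i'' 0 + c = n \<and> remaining s' = remaining s" for c s'
  have "wp B (While ?e ?c) (\<lambda>t s'. t \<le> (n - s ''i'' 0) * ((extend_time + 7) + 3) + 2 \<and>
      unchanged ?c s s' \<and> val ?e s' = 0 \<and> (\<exists>c\<le>n - s ''i'' 0. I c s')) s"
  proof (rule wp_While)
    show "I (n - s ''i'' 0) s" using assms by (simp add: I_def node_def)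
  next
    fix c s'
    assume I: "I c s'" and e: "val ?e s' \<noteq> 0"
    define i a where "i = s' ''i'' 0" and "a = s' ''a''"
    have st: "loaded s'" and a1: "\<forall>u<i. a u \<le> 1" and ne: "below i a \<noteq> {}" and c: "i + c = n"
      and rem: "below i a \<union> after i a = remaining s"
      using I by (simp_all add: I_def node_def remaining_def i_def a_def)
    have i: "i < n" using e st by (simp add: i_def loadedD)
    let ?s = "s'(''a'' := a(i := 1), ''i'' := (s' ''i'')(0 := Suc i))"
    have st': "loaded ?s" using st by (simp add: loaded_def)
    have "below i (a(i := 1)) = below i a" by (rule below_cong) simp
    with ne have ne': "below i (a(i := 1)) \<noteq> {}" by simp
    have "wp B extend (\<lambda>t s'. t \<le> extend_time \<and>
      s' ''f'' 0 = of_bool (below (Suc i) (?s ''a'') \<noteq> {})) ?s"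
      using a1 i ne' by (intro wp_extend'[OF st']) auto
    then have "wp B extend (\<lambda>t. wp B ?r (\<lambda>t' s''. 1 + (1 + (t + t' + 1) + 1) + 1 \<le> extend_time + 7 \<and> I (c - 1) s'')) ?s"
    proof (rule wp_conseq, goal_cases)
      case (1 t s1)
      then have fr: "s1 ''i'' 0 = Suc i" "s1 ''a'' = a(i := 1)" and st1: "loaded s1"
        using st' by (simp_all add: unchanged_def loaded_def)
      have f: "s1 ''f'' 0 = of_bool (below (Suc i) (a(i := 1)) \<noteq> {})" and t: "t \<le> extend_time"
        using 1 by simp_all
      show ?case
      proof (cases "below (Suc i) (a(i := 1)) = {}")
        case False
        have "I (c - 1) s1"
          using fr st1 c i a1 False rem branch_1[of i a]
          by (simp add: I_def node_def remaining_def All_less_Suc)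
        then show ?thesis using f False t by simp
      next
        case True
        let ?s1 = "s1(''a'' := a(i := 0))"
        have "a(i := 1, i := 0) = a(i := 0)" by simp
        have "loaded ?s1" using st1 by (simp add: loaded_def)
        moreover have "\<forall>u<Suc i. (a(i := 0)) u \<le> 1" using a1 by (simp add: All_less_Suc)
        ultimately have "I (c - 1) ?s1"
          using fr c i ne rem branch_0[OF True]
          by (simp add: I_def node_def remaining_def del: fun_upd_apply) (simp add: fun_upd_def)
        moreover have "i \<le> B" using i B_ge by simp
        ultimately show ?thesis using f True t fr by simp
      qed
    qed
    moreover have "i \<le> B" "Suc i \<le> B" "1 \<le> B" using i B_ge by simp_all
    ultimately have "wp B ?c (\<lambda>t s''. t \<le> extend_time + 7 \<and> I (c - 1) s'') s'"
      by (simp add: i_def a_def del: wp_Cond)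
    then show "0 < c \<and> wp B ?c (\<lambda>t s''. t \<le> extend_time + 7 \<and> I (c - 1) s'') s'"
      using i c by simp
  qed
  then show ?thesis
    unfolding descend_def
  proof (rule wp_mono, goal_cases)
    case (1 t s')
    then obtain c where I: "I c s'" by blast
    have "t \<le> (n - s ''i'' 0) * (extend_time + 10) + 2" using 1 by (simp add: add.assoc)
    also have "\<dots> \<le> n * (extend_time + 10) + 2" by (intro add_le_mono mult_le_mono) simp_all
    finally have "t \<le> n * (extend_time + 10) + 2" .
    moreover have "s' ''i'' 0 = n" using 1 I by (simp add: I_def node_def loadedD)
    ultimately show ?case using I by (simp add: I_def)
  qed
qed

lemma wp_ascend:
  assumes "node s" "s ''i'' 0 = n"
  shows "wp B ascend (\<lambda>t s'. t \<le> n * (extend_time + 9) + 4 \<and>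
    (if s' ''f'' 0 = 0 then loaded s' \<and> after n (s ''a'') = {}
     else node s' \<and> remaining s' = after n (s ''a''))) s"
proof -
  let ?s = "s(''f'' := (s ''f'')(0 := 0))"
  let ?r = "Cond (var ''f'') Skip (assign ''i'' (Minus (var ''i'') (N 1)))"
  let ?c = "Cond (Cell ''a'' (Minus (var ''i'') (N 1)))
       (Seq (Assign ''a'' (Minus (var ''i'') (N 1)) (N 0)) (Seq extend ?r))
       (assign ''i'' (Minus (var ''i'') (N 1)))"
  let ?e = "Times (var ''i'') (Minus (N 1) (var ''f''))"
  let ?R = "after n (s ''a'')"
  \<comment> \<open>With \<open>f\<close> = 0 the subtree of the current node is finished, so only
    \<open>after\<close> is still owed; with \<open>f\<close> = 1 the node has just been entered and
    its subtree is owed as well.\<close>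
  define I where "I c s' \<longleftrightarrow> node s' \<and>
    (if s' ''f'' 0 = 0 then s' ''i'' 0 \<le> c \<and> after (s' ''i'' 0) (s' ''a'') = ?R
     else s' ''f'' 0 = 1 \<and> remaining s' = ?R)" for c s'
  have "wp B (While ?e ?c) (\<lambda>t s'. t \<le> n * ((extend_time + 6) + 3) + 2 \<and>
      unchanged ?c ?s s' \<and> val ?e s' = 0 \<and> (\<exists>c\<le>n. I c s')) ?s"
  proof (rule wp_While)
    show "I n ?s" using assms by (simp add: I_def node_def loaded_def)
  next
    fix c s'
    assume I: "I c s'" and e: "val ?e s' \<noteq> 0"
    have f0: "s' ''f'' 0 = 0" using e by simp
    define i a where "i = s' ''i'' 0 - 1" and "a = s' ''a''"
    have i: "s' ''i'' 0 = Suc i" using e by (simp add: i_def)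
    have st: "loaded s'" and a1: "\<forall>u<Suc i. a u \<le> 1" and ne: "below (Suc i) a \<noteq> {}" and c: "Suc i \<le> c"
      and R: "after (Suc i) a = ?R" and n: "i < n"
      using I f0 by (simp_all add: I_def node_def a_def i)
    have ne1: "below i a \<noteq> {}" using ne by (auto simp: below_Suc)
    have B: "i \<le> B" using n B_ge by simp
    have "wp B ?c (\<lambda>t s''. t \<le> extend_time + 6 \<and> I (c - 1) s'') s'"
    proof (cases "a i = 0")
      case True
      have "loaded (s'(''i'' := (s' ''i'')(0 := i)))" using st by (simp add: loaded_def)
      then have "I (c - 1) (s'(''i'' := (s' ''i'')(0 := i)))"
        using a1 n c ne1 R f0 True
        by (simp add: I_def node_def after_Suc flip: a_def)
      then show ?thesis using True B by (simp add: i flip: a_def)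
    next
      case False
      let ?s' = "s'(''a'' := a(i := 0))"
      have st': "loaded ?s'" using st by (simp add: loaded_def)
      have eqs: "below i (a(i := 0)) = below i a" "after i (a(i := 0)) = after i a"
        by (intro below_cong after_cong; simp)+
      have a1': "\<forall>u<Suc i. (a(i := 0)) u \<le> 1" "\<forall>u<i. (a(i := 0)) u \<le> 1"
        using a1 by simp_all
      have "wp B extend (\<lambda>t s'. t \<le> extend_time \<and>
        s' ''f'' 0 = of_bool (below (Suc i) (?s' ''a'') \<noteq> {})) ?s'"
        using a1 i n ne1 eqs by (intro wp_extend'[OF st']) (auto simp: less_Suc_eq_le)
      then have "wp B extend (\<lambda>t. wp B ?r (\<lambda>t' s''. 1 + (t + t' + 1) + 1 + 1 \<le> extend_time + 6 \<and> I (c - 1) s'')) ?s'"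
      proof (rule wp_conseq, goal_cases)
        case (1 t s1)
        then have fr: "s1 ''i'' = s' ''i''" "s1 ''a'' = a(i := 0)" and st1: "loaded s1"
          using st' by (simp_all add: unchanged_def loaded_def)
        have f: "s1 ''f'' 0 = of_bool (below (Suc i) (a(i := 0)) \<noteq> {})" and t: "t \<le> extend_time"
          using 1 by simp_all
        show ?case
        proof (cases "below (Suc i) (a(i := 0)) = {}")
          case False
          have "I (c - 1) s1"
            using fr st1 n i a1' False R turn(1)[of a i, OF \<open>a i \<noteq> 0\<close>] f
            by (simp add: I_def node_def remaining_def del: fun_upd_apply)
          then show ?thesis using f False t by simp
        next
          case True
          let ?s1 = "s1(''i'' := (s1 ''i'')(0 := i))"
          have "after i (a(i := 0)) = ?R"
            using True R turn[of a i, OF \<open>a i \<noteq> 0\<close>] eqs by simp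
          moreover have "loaded ?s1" using st1 by (simp add: loaded_def)
          moreover have "?s1 ''i'' 0 = i" "?s1 ''f'' 0 = 0" "?s1 ''a'' = a(i := 0)"
            using fr f True by simp_all
          ultimately have "I (c - 1) ?s1"
            unfolding I_def node_def using n c ne1 eqs a1'(2) by (simp del: fun_upd_apply)
          then show ?thesis using f True t fr i B by simp
        qed
      qed
      then show ?thesis using False B by (subst wp_Cond) (simp add: i del: wp_Cond flip: a_def)
    qed
    then show "0 < c \<and> wp B ?c (\<lambda>t s''. t \<le> extend_time + 6 \<and> I (c - 1) s'') s'"
      using c by simp
  qed
  then have "wp B (While ?e ?c) (\<lambda>t s'. t + 2 \<le> n * (extend_time + 9) + 4 \<and>
    (if s' ''f'' 0 = 0 then loaded s' \<and> ?R = {} else node s' \<and> remaining s' = ?R)) ?s"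
  proof (rule wp_mono, goal_cases)
    case (1 t s')
    then obtain c where I: "I c s'" by blast
    \<comment> \<open>The loop left with \<open>f\<close> = 0 has reached the root, where nothing
      branches off to the right.\<close>
    have "?R = {}" if "s' ''f'' 0 = 0"
      using that 1 I by (simp add: I_def after_0)
    then show ?case using 1 I by (auto simp: I_def node_def add.assoc)
  qed
  then show ?thesis unfolding ascend_def by simp
qed

end

section \<open>Printing all transversals\<close>

definition enumerate :: com where
  "enumerate = Seq (assign ''i'' (N 0)) (Seq extend enum_loop)"

definition code :: "nat \<Rightarrow> (nat \<Rightarrow> nat) \<Rightarrow> nat set \<Rightarrow> nat list" where
  "code n p T = map p (filter (\<lambda>j. j \<in> T) [0..<n])"

context incidence
begin

lemma exec_print_loop:
  assumes "loaded s" "s ''j'' 0 + k = n"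
  shows "\<exists>ls s'. exec B print_loop s ls s' \<and> Flush \<notin> set ls \<and> length ls \<le> k * 7 + 2 \<and>
    puts ls = map (s ''p'') (filter (\<lambda>j. s ''a'' j \<noteq> 0) [s ''j'' 0..<n])"
  using assms
proof (induction k arbitrary: s)
  case 0
  then have "exec B print_loop s [Tick, Tick] s"
    unfolding print_loop_def by (intro exec_While exec_CondF exec_Skip) (simp add: loadedD)
  then show ?case using 0 by (intro exI[of _ "[Tick, Tick]"] exI[of _ s]) simp
next
  case (Suc k)
  let ?j = "s ''j'' 0"
  let ?c = "Cond (Cell ''a'' (var ''j'')) (Write (Cell ''p'' (var ''j''))) Skip"
  let ?s = "s(''j'' := (s ''j'')(0 := Suc ?j))"
  define ls1 where "ls1 = (if s ''a'' ?j = 0 then [Tick] else [Tick, Put (s ''p'' ?j)])"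
  have "exec B ?c s ls1 s"
  proof (cases "s ''a'' ?j = 0")
    case True
    then show ?thesis using exec_CondF[OF _ exec_Skip] by (simp add: ls1_def)
  next
    case False
    have "exec B (Write (Cell ''p'' (var ''j''))) s [Put (s ''p'' ?j)] s"
      using exec_Write[of B "Cell ''p'' (var ''j'')" s] by simp
    then show ?thesis using False exec_CondT by (simp add: ls1_def)
  qed
  moreover have "exec B (assign ''j'' (Plus (var ''j'') (N 1))) s [Tick] ?s"
    using exec_Assign[of "N 0" s B "Plus (var ''j'') (N 1)" "''j''"] B_ge Suc(3) by simp
  ultimately have c: "exec B (Seq ?c (assign ''j'' (Plus (var ''j'') (N 1)))) s (ls1 @ [Tick, Tick]) ?s"
    by (rule exec_Seq)
  have "loaded ?s" using Suc(2) by (simp add: loaded_def)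
  moreover have "?s ''j'' 0 + k = n" using Suc(3) by simp
  ultimately obtain ls s' where ls: "exec B print_loop ?s ls s'" "Flush \<notin> set ls" "length ls \<le> k * 7 + 2"
    "puts ls = map (?s ''p'') (filter (\<lambda>j. ?s ''a'' j \<noteq> 0) [?s ''j'' 0..<n])"
    using Suc.IH by blast
  have "exec B print_loop s (Tick # Tick # (ls1 @ [Tick, Tick]) @ Tick # ls) s'"
    unfolding print_loop_def
    using Suc(2,3)
    by (intro exec_While exec_CondT exec_Seq[OF c ls(1)[unfolded print_loop_def]]) (simp add: loadedD)
  moreover have "[?j..<n] = ?j # [Suc ?j..<n]" using Suc(3) by (intro upt_conv_Cons) simp
  ultimately show ?case
    using ls by (intro exI[of _ "Tick # Tick # (ls1 @ [Tick, Tick]) @ Tick # ls"] exI[of _ s'])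
      (simp add: ls1_def)
qed

lemma exec_print_set:
  assumes "loaded s"
  shows "\<exists>ls s'. exec B print_set s (ls @ [Flush]) s' \<and> Flush \<notin> set ls \<and> length ls \<le> n * 7 + 5 \<and>
    puts ls = code n (s ''p'') (pref n (s ''a''))"
proof -
  let ?s = "s(''j'' := (s ''j'')(0 := 0))"
  have "loaded ?s" "?s ''j'' 0 + n = n" using assms by (simp_all add: loaded_def)
  from exec_print_loop[OF this] obtain ls s' where ls: "exec B print_loop ?s ls s'" "Flush \<notin> set ls"
    "length ls \<le> n * 7 + 2"
    "puts ls = map (?s ''p'') (filter (\<lambda>j. ?s ''a'' j \<noteq> 0) [?s ''j'' 0..<n])"
    by blast
  have "exec B (assign ''j'' (N 0)) s [Tick] ?s"
    using exec_Assign[of "N 0" s B "N 0" "''j''"] by simp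
  then have "exec B print_set s ([Tick] @ Tick # (ls @ Tick # [Flush])) s'"
    unfolding print_set_def by (rule exec_Seq[OF _ exec_Seq[OF ls(1) exec_Output]])
  moreover have "filter (\<lambda>j. s ''a'' j \<noteq> 0) [0..<n] = filter (\<lambda>j. j \<in> pref n (s ''a'')) [0..<n]"
    by (rule filter_cong) (simp_all add: pref_def)
  ultimately show ?thesis
    using ls by (intro exI[of _ "Tick # Tick # ls @ [Tick]"] exI[of _ s']) (simp add: code_def)
qed

text \<open>The sets still owed leave the path of the printed one at a vertex that it contains,
  because in-branches come first. This is the source of the output order.\<close>

lemma after_lex_before: "T \<in> after n a \<Longrightarrow> lex_before (pref n a) T"
proof -
  assume "T \<in> after n a"
  then obtain j where j: "j < n" "T \<inter> {..<j} = pref j a" "a j \<noteq> 0" "j \<notin> T"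
    unfolding after_def by blast
  moreover have "pref n a \<inter> {..<j} = pref j a" using j(1) by (auto simp: pref_def)
  ultimately show ?thesis
    unfolding lex_before_def by (intro exI[of _ j]) (simp add: pref_def)
qed

lemma wp_exec:
  assumes "wp B c Q s"
  obtains ls s' where "exec B c s ls s'" "Flush \<notin> set ls" "puts ls = []" "Q (length ls) s'"
    "unchanged c s s'"
proof -
  from wp_frame[OF assms] obtain ls s' where "exec B c s ls s'" "set ls \<subseteq> {Tick}" "Q (length ls) s'"
    "unchanged c s s'"
    unfolding wp_def by blast
  with that puts_ticks show ?thesis by (metis empty_iff event.distinct(3) insert_iff subsetD)
qed

text \<open>A gap between outputs is an ascent followed by a descent with printing; the additive
  constants cover the sequencing steps around them.\<close>

definition ascend_time :: nat where "ascend_time = n * (extend_time + 9) + 6"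
definition descend_time :: nat where "descend_time = n * (extend_time + 10) + n * 7 + 12"

text \<open>\<open>t\<close> is the time since the last output when the loop is entered. It must be
  universal, since for the remaining rounds it is the length of the preceding ascent, while at the
  start it comes from the preparation; hence the maximum. The induction is on the set still to be
  printed, from which each round removes one element.\<close>

lemma exec_enum_loop:
  assumes "if s ''f'' 0 = 0 then M = {} else node s \<and> remaining s = M" "finite M"
  shows "\<exists>ls s' Ts. exec B enum_loop s ls s' \<and> outputs ls = map (code n (s ''p'')) Ts \<and>
    distinct Ts \<and> set Ts = M \<and> sorted_wrt lex_before Ts \<and>
    (\<forall>t. \<forall>g\<in>set (gaps_from t ls). g \<le> max t ascend_time + descend_time)"
  using assms(2,1)
proof (induction M arbitrary: s rule: finite_psubset_induct)
  case (psubset M)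
  show ?case
  proof (cases "s ''f'' 0 = 0")
    case True
    then have "exec B enum_loop s [Tick, Tick] s"
      unfolding enum_loop_def by (intro exec_While exec_CondF exec_Skip) simp
    moreover have "Suc (Suc t) \<le> max t ascend_time + descend_time" for t
      unfolding descend_time_def by linarith
    ultimately show ?thesis using True psubset(3)
      by (intro exI[of _ "[Tick, Tick]"] exI[of _ s] exI[of _ "[]"])
        (simp add: outputs_def)
  next
    case False
    then have s: "node s" "remaining s = M" using psubset(3) by simp_all
    from wp_descend[OF s(1)] obtain ls1 s1 where
      1: "exec B descend s ls1 s1" "Flush \<notin> set ls1" "puts ls1 = []"
        "length ls1 \<le> n * (extend_time + 10) + 2" "node s1" "s1 ''i'' 0 = n" "remaining s1 = M"
        "s1 ''p'' = s ''p''"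
      by (rule wp_exec) (use s in \<open>simp add: unchanged_def\<close>)
    have st1: "loaded s1" using 1(5) by (simp add: node_def)
    define S where "S = pref n (s1 ''a'')"
    have below: "below n (s1 ''a'') = {S}"
      using 1(5,6) below_n[of _ "s1 ''a''"] by (auto simp: node_def S_def)
    define M' where "M' = after n (s1 ''a'')"
    have M: "M = insert S M'" "S \<notin> M'"
      using 1(6,7) below below_n_not_after[of "s1 ''a''"] by (auto simp: remaining_def M'_def)
    from exec_print_set[OF st1] obtain ls2 s2 where
      2: "exec B print_set s1 (ls2 @ [Flush]) s2" "Flush \<notin> set ls2" "length ls2 \<le> n * 7 + 5"
        "puts ls2 = code n (s ''p'') S"
      using 1(8) by (auto simp: S_def)
    have fr2: "s2 ''a'' = s1 ''a''" "s2 ''i'' = s1 ''i''" "s2 ''p'' = s1 ''p''" "loaded s2"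
      using exec_frame[OF 2(1)] st1 by (simp_all add: loaded_def)
    have "node s2" using 1(5) fr2 by (simp add: node_def)
    moreover have "s2 ''i'' 0 = n" using fr2 1(6) by simp
    ultimately have "wp B ascend (\<lambda>t s'. t \<le> n * (extend_time + 9) + 4 \<and>
      (if s' ''f'' 0 = 0 then loaded s' \<and> after n (s2 ''a'') = {}
       else node s' \<and> remaining s' = after n (s2 ''a''))) s2"
      by (rule wp_ascend)
    then obtain ls3 s3 where
      3: "exec B ascend s2 ls3 s3" "Flush \<notin> set ls3" "puts ls3 = []"
        "length ls3 \<le> n * (extend_time + 9) + 4"
        "if s3 ''f'' 0 = 0 then M' = {} else node s3 \<and> remaining s3 = M'"
        "s3 ''p'' = s ''p''"
      by (rule wp_exec) (use fr2 1(8) in \<open>simp add: unchanged_def M'_def split: if_splits\<close>)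
    have "M' \<subset> M" using M by blast
    from psubset.IH[OF this 3(5)] obtain ls s' Ts where
      4: "exec B enum_loop s3 ls s'" "outputs ls = map (code n (s3 ''p'')) Ts"
        "distinct Ts" "set Ts = M'" "sorted_wrt lex_before Ts"
        "\<forall>t. \<forall>g\<in>set (gaps_from t ls). g \<le> max t ascend_time + descend_time"
      by blast
    \<comment> \<open>Regrouped at the \<open>Flush\<close>: the events before it complete the
      running gap, the ascent after it opens the next.\<close>
    let ?ls = "(Tick # Tick # ls1 @ Tick # ls2) @ Flush # (Tick # ls3 @ [Tick]) @ ls"
    have body: "exec B (Seq descend (Seq print_set ascend)) s (ls1 @ Tick # ((ls2 @ [Flush]) @ Tick # ls3)) s3"
      by (rule exec_Seq[OF 1(1) exec_Seq[OF 2(1) 3(1)]])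
    have "exec B enum_loop s
        (Tick # Tick # ((ls1 @ Tick # ((ls2 @ [Flush]) @ Tick # ls3)) @ Tick # ls)) s'"
      using False unfolding enum_loop_def
      by (intro exec_While exec_CondT exec_Seq[OF body 4(1)[unfolded enum_loop_def]]) simp
    then have "exec B enum_loop s ?ls s'" by simp
    moreover have "outputs ?ls = map (code n (s ''p'')) (S # Ts)"
    proof -
      have "outputs_from [] ?ls = code n (s ''p'') S # outputs_from [] ((Tick # ls3 @ [Tick]) @ ls)"
        using 1(2,3) 2(2,4) by (subst outputs_from_append) simp_all
      also have "outputs_from [] ((Tick # ls3 @ [Tick]) @ ls) = outputs_from [] ls"
        using 3(2,3) by (subst outputs_from_append) simp_all
      finally show ?thesis using 4(2) 3(6) by (simp add: outputs_def)
    qed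
    moreover have "distinct (S # Ts)" "set (S # Ts) = M" using 4(3,4) M by simp_all
    moreover have "sorted_wrt lex_before (S # Ts)"
      using 4(4,5) after_lex_before by (simp add: S_def M'_def)
    moreover have "g \<le> max t ascend_time + descend_time" if g: "g \<in> set (gaps_from t ?ls)" for t g
    proof -
      have "gaps_from t ?ls =
        Suc (t + length (Tick # Tick # ls1 @ Tick # ls2)) # gaps_from 0 ((Tick # ls3 @ [Tick]) @ ls)"
        using 1(2) 2(2) by (subst gaps_from_append) simp_all
      also have "gaps_from 0 ((Tick # ls3 @ [Tick]) @ ls) = gaps_from (length ls3 + 2) ls"
        using 3(2) by (subst gaps_from_append) simp_all
      finally consider "g = t + length ls1 + length ls2 + 4" | "g \<in> set (gaps_from (length ls3 + 2) ls)"
        using g by auto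
      then show ?thesis
      proof cases
        case 1
        then show ?thesis using \<open>length ls1 \<le> _\<close> 2(3) by (simp add: descend_time_def)
      next
        case 2
        then have "g \<le> max (length ls3 + 2) ascend_time + descend_time" using 4(6) by blast
        then show ?thesis using 3(4) by (simp add: ascend_time_def)
      qed
    qed
    ultimately show ?thesis by blast
  qed
qed

lemma exec_enumerate:
  assumes "loaded s"
  shows "\<exists>ls s' Ts. exec B enumerate s ls s' \<and> outputs ls = map (code n (s ''p'')) Ts \<and>
    distinct Ts \<and> set Ts = transversals \<and> sorted_wrt lex_before Ts \<and>
    (\<forall>t. \<forall>g\<in>set (gaps_from t ls). g \<le> t + extend_time + ascend_time + descend_time)"
proof -
  let ?s = "s(''i'' := (s ''i'')(0 := 0))"
  have st: "loaded ?s" using assms by (simp add: loaded_def)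
  \<comment> \<open>The test at the root decides whether there is any transversal at all; it fails
    exactly if some edge is empty.\<close>
  have "wp B extend (\<lambda>t s'. t \<le> extend_time \<and>
    s' ''f'' 0 = of_bool (below 0 (?s ''a'') \<noteq> {})) ?s"
    unfolding extend_time_def
    by (intro wp_extend[OF st]) (simp_all add: card_transversal_le_hrank pref_def)
  then obtain ls1 s1 where 1: "exec B extend ?s ls1 s1" "Flush \<notin> set ls1" "puts ls1 = []"
      "length ls1 \<le> extend_time" "s1 ''f'' 0 = of_bool (transversals \<noteq> {})" "unchanged extend ?s s1"
    by (rule wp_exec) (simp add: below_0)
  have fr: "s1 ''i'' 0 = 0" "s1 ''p'' = s ''p''" "loaded s1"
    using 1(6) st by (simp_all add: unchanged_def loaded_def)
  then have "if s1 ''f'' 0 = 0 then transversals = {} else node s1 \<and> remaining s1 = transversals"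
    using 1(5) by (simp add: node_def remaining_def below_0 after_0)
  from exec_enum_loop[OF this finite_transversals] obtain ls s' Ts where
    2: "exec B enum_loop s1 ls s'" "outputs ls = map (code n (s1 ''p'')) Ts"
      "distinct Ts" "set Ts = transversals" "sorted_wrt lex_before Ts"
      "\<forall>t. \<forall>g\<in>set (gaps_from t ls). g \<le> max t ascend_time + descend_time"
    by blast
  let ?pre = "Tick # Tick # ls1 @ [Tick]"
  have "exec B (assign ''i'' (N 0)) s [Tick] ?s"
    using exec_Assign[of "N 0" s B "N 0" "''i''"] by simp
  then have "exec B enumerate s ([Tick] @ Tick # (ls1 @ Tick # ls)) s'"
    unfolding enumerate_def by (rule exec_Seq[OF _ exec_Seq[OF 1(1) 2(1)]])
  then have "exec B enumerate s (?pre @ ls) s'" by simp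
  moreover have "outputs (?pre @ ls) = map (code n (s ''p'')) Ts"
    using 1(2,3) 2(2) fr(2) unfolding outputs_def by (subst outputs_from_append) simp_all
  moreover have "g \<le> t + extend_time + ascend_time + descend_time" if "g \<in> set (gaps_from t (?pre @ ls))" for t g
  proof -
    have "gaps_from t (?pre @ ls) = gaps_from (t + length ?pre) ls"
      using 1(2) by (subst gaps_from_append) simp_all
    then have "g \<le> max (t + length ?pre) ascend_time + descend_time" using that 2(6) by metis
    moreover have "6 \<le> ascend_time" by (simp add: ascend_time_def)
    ultimately show ?thesis using 1(4) by simp
  qed
  ultimately show ?thesis using 2(3-5) by blast
qed

end

text \<open>Ranking by counting predecessors: the order being reflexive, a vertex counts itself, so
  its position is one less than the count. The quadratic time falls into the first gap, where the
  delay bound permits it.\<close>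

definition sort_vertices :: com where
  "sort_vertices = for_to ''j'' ''n'' (Seq (assign ''g'' (N 0)) (Seq
     (for_to ''v'' ''n'' (assign ''g'' (Plus (var ''g'')
       (Cell ''ord'' (Plus (Times (var ''v'') (var ''n'')) (var ''j''))))))
     (Assign ''p'' (Minus (var ''g'') (N 1)) (var ''j''))))"

lemma writes_sort_vertices[simp]: "writes sort_vertices = {''j'', ''g'', ''v'', ''p''}"
  by (auto simp: sort_vertices_def)

lemma wp_sort_vertices:
  assumes "s ''n'' 0 = n" "n \<le> B" "\<And>j v. j < n \<Longrightarrow> v < n \<Longrightarrow> s ''ord'' (v * n + j) = of_bool (P v j)"
    and "inj_on (\<lambda>j. card {v. v < n \<and> P v j} - 1) {..<n}"
  shows "wp B sort_vertices (\<lambda>t s'. t \<le> n * (n * 6 + 13) + 4 \<and>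
    (\<forall>j<n. s' ''p'' (card {v. v < n \<and> P v j} - 1) = j)) s"
proof -
  define rk where "rk j = card {v. v < n \<and> P v j}" for j
  let ?inner = "for_to ''v'' ''n'' (assign ''g'' (Plus (var ''g'')
       (Cell ''ord'' (Plus (Times (var ''v'') (var ''n'')) (var ''j'')))))"
  define place where "place = Assign ''p'' (Minus (var ''g'') (N 1)) (var ''j'')"
  have card_Suc: "card {v. v < Suc k \<and> P v j} = card {v. v < k \<and> P v j} + of_bool (P k j)" for k j
  proof -
    have "{v. v < Suc k \<and> P v j} = {v. v < k \<and> P v j} \<union> (if P k j then {k} else {})"
      by (auto simp: less_Suc_eq)
    then show ?thesis by simp
  qed
  have card_le: "card {v. v < k \<and> P v j} \<le> k" for k j
    by (induction k) (simp_all add: card_Suc)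
  have "wp B sort_vertices (\<lambda>t s'. t \<le> n * ((n * 6 + 8) + 5) + 4 \<and> s' ''j'' 0 = n \<and>
    (\<forall>j<n. s' ''p'' (rk j - 1) = j)) s"
    unfolding sort_vertices_def
  proof (rule wp_for_to[where I = "\<lambda>k s'. \<forall>j<k. s' ''p'' (rk j - 1) = j"], goal_cases)
    case (7 k s')
    let ?s = "s'(''g'' := (s' ''g'')(0 := 0))"
    have fr: "?s ''n'' 0 = n" "?s ''ord'' = s ''ord''" "?s ''j'' 0 = k" "?s ''g'' 0 = 0"
      using 7(2,3) assms(1) by (simp_all add: unchanged_def)
    have "wp B ?inner (\<lambda>t s''. t \<le> n * (1 + 5) + 4 \<and> s'' ''v'' 0 = n \<and> s'' ''g'' 0 = card {v. v < n \<and> P v k}) ?s"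
    proof (rule wp_for_to[where I = "\<lambda>l s''. s'' ''g'' 0 = card {v. v < l \<and> P v k}"], goal_cases)
      case (7 l s'')
      then have "s'' ''n'' 0 = n" "s'' ''ord'' = s ''ord''" "s'' ''j'' 0 = k"
        using fr by (simp_all add: unchanged_def)
      moreover have "card {v. v < Suc l \<and> P v k} \<le> B" using card_le[of "Suc l" k] 7(4) assms(2) by linarith
      ultimately show ?case
        using 7(1,3,4) assms(3)[of k l] \<open>k < n\<close> by (simp add: card_Suc)
    qed (use fr assms(2) in simp_all)
    then have "wp B ?inner (\<lambda>t. wp B place
      (\<lambda>t' s''. 1 + (t + t' + 1) + 1 \<le> n * 6 + 8 \<and>
        (\<forall>j<Suc k. (s''(''j'' := (s'' ''j'')(0 := Suc k))) ''p'' (rk j - 1) = j))) ?s"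
    proof (rule wp_conseq, goal_cases)
      case (1 t s'')
      then have p: "s'' ''p'' = s' ''p''" "s'' ''j'' 0 = k" using fr by (simp_all add: unchanged_def)
      have g: "s'' ''g'' 0 = rk k" using 1(1) by (simp add: rk_def)
      have "rk k \<le> B" using card_le[of n k] assms(2) by (simp add: rk_def)
      \<comment> \<open>Ranks are distinct, so storing \<open>k\<close> overwrites no earlier entry
        of \<open>p\<close>.\<close>
      moreover have "rk j - 1 \<noteq> rk k - 1" if "j < k" for j
        using inj_onD[OF assms(4), of j k] that \<open>k < n\<close> by (auto simp: rk_def)
      ultimately show ?case
        using 1(1) 7(1) p g \<open>k < n\<close> assms(2) by (simp add: All_less_Suc place_def)
    qed
    then show ?case by (simp del: One_nat_def flip: place_def)
  qed (use assms(1,2) in simp_all)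
  then show ?thesis by (rule wp_mono) (simp add: rk_def add.assoc)
qed

section \<open>The enumeration algorithm\<close>

lemma hitting_set_image:
  assumes "bij_betw f U V" "H \<subseteq> Pow U" "T \<subseteq> U"
  shows "hitting_set V ((`) f ` H) (f ` T) \<longleftrightarrow> hitting_set U H T"
proof -
  have inj: "inj_on f U" and V: "f ` U = V" using assms(1) by (simp_all add: bij_betw_def)
  have "f ` T \<inter> f ` E \<noteq> {} \<longleftrightarrow> T \<inter> E \<noteq> {}" if "E \<in> H" for E
  proof -
    have "E \<subseteq> U" using assms(2) that by blast
    then have "f ` (T \<inter> E) = f ` T \<inter> f ` E" by (rule inj_on_image_Int[OF inj assms(3)])
    then show ?thesis by (metis image_is_empty)
  qed
  moreover have "f ` T \<subseteq> V" using V assms(3) by blast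
  ultimately show ?thesis using assms(3) by (simp add: hitting_set_def)
qed

lemma minimal_hitting_set_image:
  assumes "bij_betw f U V" "H \<subseteq> Pow U" "T \<subseteq> U"
  shows "minimal_hitting_set V ((`) f ` H) (f ` T) \<longleftrightarrow> minimal_hitting_set U H T"
proof -
  have inj: "inj_on f U" using assms(1) by (simp add: bij_betw_def)
  note hit = hitting_set_image[OF assms(1,2)]
  have "(\<exists>T'. T' \<subset> f ` T \<and> hitting_set V ((`) f ` H) T') \<longleftrightarrow> (\<exists>S. S \<subset> T \<and> hitting_set U H S)"
  proof
    assume "\<exists>T'. T' \<subset> f ` T \<and> hitting_set V ((`) f ` H) T'"
    then obtain T' where T': "T' \<subset> f ` T" "hitting_set V ((`) f ` H) T'" by (elim exE conjE)
    then obtain S where S: "S \<subseteq> T" "T' = f ` S" by (meson psubset_imp_subset subset_imageE)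
    with T' have "S \<noteq> T" by blast
    moreover have "hitting_set U H S" using T'(2) S assms(3) hit[of S] by simp
    ultimately show "\<exists>S. S \<subset> T \<and> hitting_set U H S" using S(1) by (intro exI[of _ S]) simp
  next
    assume "\<exists>S. S \<subset> T \<and> hitting_set U H S"
    then obtain S where S: "S \<subset> T" "hitting_set U H S" by (elim exE conjE)
    have "S \<subseteq> U" using S(1) assms(3) by simp
    moreover have "f ` S \<subset> f ` T"
      by (rule image_strict_mono[OF inj_on_subset[OF inj assms(3)] S(1)])
    ultimately show "\<exists>T'. T' \<subset> f ` T \<and> hitting_set V ((`) f ` H) T'"
      using S(2) hit[of S] by (intro exI[of _ "f ` S"]) simp
  qed
  then show ?thesis unfolding minimal_hitting_set_def using hit[OF assms(3)] by simp
qed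

lemma Tr_image:
  assumes "bij_betw f U V" "H \<subseteq> Pow U"
  shows "Tr V ((`) f ` H) = (`) f ` Tr U H"
proof
  show "Tr V ((`) f ` H) \<subseteq> (`) f ` Tr U H"
  proof
    fix T assume "T \<in> Tr V ((`) f ` H)"
    then have T: "minimal_hitting_set V ((`) f ` H) T" by (simp add: Tr_def)
    then have "T \<subseteq> f ` U" using minimal_hitting_setD(1) assms(1) by (metis bij_betw_def)
    then obtain S where S: "S \<subseteq> U" "T = f ` S" by (rule subset_imageE)
    then have "S \<in> Tr U H"
      using T minimal_hitting_set_image[OF assms S(1)] by (simp add: Tr_def)
    then show "T \<in> (`) f ` Tr U H" using S(2) by simp
  qed
  show "(`) f ` Tr U H \<subseteq> Tr V ((`) f ` H)"
  proof (rule image_subsetI)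
    fix T assume "T \<in> Tr U H"
    then have T: "minimal_hitting_set U H T" by (simp add: Tr_def)
    then show "f ` T \<in> Tr V ((`) f ` H)"
      using minimal_hitting_set_image[OF assms minimal_hitting_setD(1)[OF T]] by (simp add: Tr_def)
  qed
qed

section \<open>Ranks in a linear order\<close>

definition position :: "'a rel \<Rightarrow> 'a list \<Rightarrow> nat \<Rightarrow> nat" where
  "position r vs j = card {v. v < length vs \<and> (vs ! v, vs ! j) \<in> r} - 1"

text \<open>The sets of predecessors are nested along \<open>r\<close>, and properly so for distinct
  vertices; hence comparing their sizes compares the vertices.\<close>

lemma position_le_iff:
  assumes r: "linear_order_on V r" and vs: "distinct vs" "set vs = V"
    and "i < length vs" "j < length vs"
  shows "position r vs i \<le> position r vs j \<longleftrightarrow> (vs ! i, vs ! j) \<in> r"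
proof -
  let ?S = "\<lambda>j. {v. v < length vs \<and> (vs ! v, vs ! j) \<in> r}"
  have V: "vs ! v \<in> V" if "v < length vs" for v using that vs(2) nth_mem by blast
  have refl: "(x, x) \<in> r" if "x \<in> V" for x
    using r that by (auto simp: order_on_defs refl_on_def)
  have trans: "trans r" and antisym: "antisym r" and total: "total_on V r"
    using r by (simp_all add: order_on_defs)
  \<comment> \<open>The counts are positive by reflexivity, so that truncated subtraction of 1
    preserves strictness.\<close>
  have pos: "0 < card (?S v)" if "v < length vs" for v
    using that refl[OF V[OF that]] by (subst card_gt_0_iff) auto
  have strict: "position r vs v < position r vs w"
    if "(vs ! v, vs ! w) \<in> r" "v \<noteq> w" "v < length vs" "w < length vs" for v w
  proof -
    have "?S v \<subseteq> ?S w" using that(1) trans by (auto dest: transD)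
    moreover have "w \<notin> ?S v"
    proof
      assume "w \<in> ?S v"
      then have "vs ! w = vs ! v" using that(1) antisymD[OF antisym] by blast
      then show False using that vs(1) by (simp add: nth_eq_iff_index_eq)
    qed
    moreover have "w \<in> ?S w" using that(4) refl V by simp
    ultimately have "?S v \<subset> ?S w" by blast
    then have "card (?S v) < card (?S w)" by (intro psubset_card_mono) simp_all
    then show ?thesis using pos[OF that(3)] by (simp add: position_def)
  qed
  show ?thesis
  proof (cases "i = j")
    case True
    then show ?thesis using refl V assms(4) by simp
  next
    case False
    then have "vs ! i \<noteq> vs ! j" using assms by (simp add: nth_eq_iff_index_eq)
    then have "(vs ! i, vs ! j) \<in> r \<or> (vs ! j, vs ! i) \<in> r"
      using total V assms(4,5) by (simp add: total_on_def)
    then show ?thesis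
      using strict[of i j] strict[of j i] False assms(4,5) antisymD[OF antisym] \<open>vs ! i \<noteq> vs ! j\<close>
      by (metis leD less_imp_le)
  qed
qed

lemma bij_position:
  assumes "linear_order_on V r" "distinct vs" "set vs = V"
  shows "bij_betw (position r vs) {..<length vs} {..<length vs}"
proof -
  have "antisym r" using assms(1) by (simp add: order_on_defs)
  have "inj_on (position r vs) {..<length vs}"
  proof (rule inj_onI)
    fix i j assume ij: "i \<in> {..<length vs}" "j \<in> {..<length vs}" "position r vs i = position r vs j"
    then have "(vs ! i, vs ! j) \<in> r" "(vs ! j, vs ! i) \<in> r"
      using position_le_iff[OF assms, of i j] position_le_iff[OF assms, of j i] by simp_all
    then have "vs ! i = vs ! j" using \<open>antisym r\<close> by (simp add: antisymD)
    then show "i = j" using ij assms(2) by (simp add: nth_eq_iff_index_eq)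
  qed
  moreover have "position r vs ` {..<length vs} \<subseteq> {..<length vs}"
  proof (rule image_subsetI)
    fix j assume "j \<in> {..<length vs}"
    have "card {v. v < length vs \<and> (vs ! v, vs ! j) \<in> r} \<le> card {..<length vs}"
      by (intro card_mono) auto
    then show "position r vs j \<in> {..<length vs}"
      using \<open>j \<in> _\<close> by (simp add: position_def)
  qed
  ultimately show ?thesis
    using endo_inj_surj[OF finite_lessThan] by (simp add: bij_betw_def)
qed

text \<open>As \<open>f\<close> is monotone, the least differing position becomes the
  \<open>r\<close>-first differing vertex; antisymmetry makes it unique, so that
  \<open>first\<close> denotes it.\<close>

lemma lex_le_image:
  assumes r: "linear_order_on V r" and f: "bij_betw f {..<n} V"
    and mono: "\<And>u v. u < n \<Longrightarrow> v < n \<Longrightarrow> u \<le> v \<Longrightarrow> (f u, f v) \<in> r"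
    and ST: "S \<subseteq> {..<n}" "T \<subseteq> {..<n}" "lex_before S T"
  shows "lex_le r (f ` S) (f ` T)"
proof -
  obtain j where j: "j \<in> S" "j \<notin> T" "S \<inter> {..<j} = T \<inter> {..<j}"
    using ST(3) unfolding lex_before_def by (elim exE conjE)
  have inj: "inj_on f {..<n}" using f by (simp add: bij_betw_def)
  let ?D = "(f ` S - f ` T) \<union> (f ` T - f ` S)"
  have D: "?D = f ` ((S - T) \<union> (T - S))"
    using inj_on_image_set_diff[OF inj, of S T] inj_on_image_set_diff[OF inj, of T S] ST(1,2)
    by (simp add: image_Un Diff_subset[THEN subset_trans])
  have le: "(f j, y) \<in> r" if y: "y \<in> ?D" for y
  proof -
    obtain v where v: "v \<in> (S - T) \<union> (T - S)" "y = f v" using y unfolding D by (elim imageE)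
    have "\<not> v < j" using v(1) j(3) by blast
    moreover have "v < n" "j < n" using v(1) j(1) ST(1,2) by blast+
    ultimately show ?thesis using mono v(2) by simp
  qed
  have fj: "f j \<in> ?D" unfolding D using j by simp
  have "first r ?D = f j"
    unfolding first_def
  proof (intro the_equality conjI ballI fj le)
    fix x assume x: "x \<in> ?D \<and> (\<forall>y\<in>?D. (x, y) \<in> r)"
    have "(x, f j) \<in> r" using x fj by (elim conjE bspec)
    moreover have "(f j, x) \<in> r" using x by (intro le) (rule conjunct1)
    moreover have "antisym r" using r by (simp add: order_on_defs)
    ultimately show "x = f j" by (simp add: antisymD)
  qed
  then show ?thesis using j(1) by (simp add: lex_le_def)
qed

lemma set_code: "T \<subseteq> {..<n} \<Longrightarrow> set (code n p T) = p ` T"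
  by (auto simp: code_def)

lemma represents_code:
  assumes "bij_betw p {..<length vs} {..<length vs}" "T \<subseteq> {..<length vs}"
  shows "represents vs (code (length vs) p T) ((\<lambda>v. vs ! p v) ` T)"
proof -
  have "inj_on p {..<length vs}" and p: "p ` {..<length vs} = {..<length vs}"
    using assms(1) by (simp_all add: bij_betw_def)
  then have "distinct (code (length vs) p T)"
    by (auto simp: code_def distinct_map intro: inj_on_subset)
  moreover have "p ` T \<subseteq> {..<length vs}" using p assms(2) by blast
  ultimately show ?thesis
    using assms(2) by (simp add: represents_def set_code image_image)
qed

text \<open>Without edges the odometer has no digits. The sole minimal hitting set is then the empty
  one, and \<open>Output\<close> with nothing written prints it.\<close>

definition algorithm :: com where
  "algorithm = Cond (var ''m'') (Seq sort_vertices enumerate) Output"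

lemma gaps_from_nonempty: "gaps_from t ls \<noteq> []"
  by (induction t ls rule: gaps_from.induct) simp_all

lemma delay_le: "(\<And>g. g \<in> set (gaps_from 0 ls) \<Longrightarrow> g \<le> c) \<Longrightarrow> delay ls \<le> c"
  unfolding delay_def using gaps_from_nonempty by (intro Max.boundedI) simp_all

text \<open>The square accommodates the addresses in the two matrices, which range up to n^2 and m
  n; the contents are at most linear.\<close>

lemma cells_bounded_input:
  "cells_bounded ((length vs + length es + 1) ^ 2) {''n'', ''m'', ''ord'', ''inc''} (input vs es r)"
proof -
  have "length vs * length vs \<le> (length vs + length es + 1) ^ 2"
    "length es * length vs \<le> (length vs + length es + 1) ^ 2"
    "length vs \<le> (length vs + length es + 1) ^ 2" "length es \<le> (length vs + length es + 1) ^ 2"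
    "1 \<le> (length vs + length es + 1) ^ 2"
    by (simp_all add: power2_eq_square algebra_simps)
  then show ?thesis
    unfolding cells_bounded_def input_def by (auto split: if_splits)
qed

lemma exec_algorithm_pos:
  fixes V :: "'a set"
  assumes H: "hypergraph V H" and r: "linear_order_on V r" and vs: "distinct vs" "set vs = V"
    and es: "set es = H" and m: "0 < length es" and B: "length vs + length es + 1 \<le> B"
  defines "n \<equiv> length vs" and "m \<equiv> length es"
  shows "\<exists>ls s. exec B algorithm (input vs es r) ls s \<and> enumerates_lex vs r (outputs ls) (Tr V H) \<and>
    delay ls \<le> 900 * ((n + 1) ^ 2 * m ^ (hrank (Tr V H) + 2))"
proof -
  \<comment> \<open>\<open>pos\<close> sends vertex numbers to positions, \<open>p\<close> is its
    inverse, which the program tabulates, and \<open>f\<close> leads from positions to the vertices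
    in \<open>V\<close>.\<close>
  define pos where "pos = position r vs"
  define p where "p = inv_into {..<n} pos"
  define f where "f v = vs ! p v" for v
  define J where "J e v \<longleftrightarrow> f v \<in> es ! e" for e v
  interpret incidence n m B J by standard (use m B in \<open>simp_all add: n_def m_def\<close>)
  have pos: "bij_betw pos {..<n} {..<n}" unfolding pos_def n_def by (rule bij_position[OF r vs])
  have p: "bij_betw p {..<n} {..<n}" unfolding p_def by (rule bij_betw_inv_into[OF pos])
  have p_less: "p v < n" if "v < n" for v using bij_betwE[OF p] that by blast
  have pos_p: "pos (p v) = v" if "v < n" for v
    unfolding p_def using bij_betw_inv_into_right[OF pos] that by simp
  have "bij_betw ((!) vs) {..<n} V" unfolding n_def by (rule bij_betw_nth[OF vs(1) refl vs(2)[symmetric]])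
  then have f: "bij_betw f {..<n} V"
    using bij_betw_trans[OF p] unfolding f_def comp_def by blast
  have mono: "(f u, f v) \<in> r" if "u < n" "v < n" "u \<le> v" for u v
    using position_le_iff[OF r vs, of "p u" "p v"] p_less pos_p that
    by (simp add: f_def n_def pos_def)
  have H_img: "H = (`) f ` edges"
  proof -
    have "f ` {v. v < n \<and> J e v} = es ! e" if "e < m" for e
    proof -
      have "es ! e \<in> H" using that es nth_mem unfolding m_def by blast
      then have "es ! e \<subseteq> f ` {..<n}" using H f by (auto simp: hypergraph_def bij_betw_def)
      then show ?thesis by (auto simp: J_def)
    qed
    then have "(\<lambda>e. f ` {v. v < n \<and> J e v}) ` {..<m} = (\<lambda>e. es ! e) ` {..<m}" by simp
    also have "\<dots> = H" using es by (auto simp: m_def set_conv_nth)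
    finally show ?thesis by (simp add: edges_def image_image)
  qed
  have "edges \<subseteq> Pow {..<n}" by (auto simp: edges_def)
  then have Tr: "Tr V H = (`) f ` transversals"
    unfolding H_img transversals_def by (rule Tr_image[OF f])
  have inj: "inj_on f {..<n}" using f by (simp add: bij_betw_def)
  have rank: "hrank (Tr V H) = hrank transversals"
  proof -
    have "card (f ` T) = card T" if "T \<in> transversals" for T
      by (rule card_image) (rule inj_on_subset[OF inj transversals_subset[OF that]])
    then show ?thesis unfolding Tr hrank_def by (simp add: image_image)
  qed
  let ?s = "input vs es r"
  have "wp B sort_vertices (\<lambda>t s'. t \<le> n * (n * 6 + 13) + 4 \<and>
    (\<forall>j<n. s' ''p'' (card {v. v < n \<and> (vs ! v, vs ! j) \<in> r} - 1) = j)) ?s"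
  proof (rule wp_sort_vertices)
    show "?s ''n'' 0 = n" "n \<le> B" using B by (simp_all add: input_def n_def)
    show "?s ''ord'' (v * n + j) = of_bool ((vs ! v, vs ! j) \<in> r)" if "j < n" "v < n" for j v
    proof -
      have "v * n + j < Suc v * n" using that by simp
      also have "\<dots> \<le> n * n" using that(2) by (intro mult_le_mono1) simp
      finally show ?thesis using that by (simp add: input_def flip: n_def)
    qed
    show "inj_on (\<lambda>j. card {v. v < n \<and> (vs ! v, vs ! j) \<in> r} - 1) {..<n}"
      using pos by (simp add: bij_betw_def pos_def position_def[abs_def] n_def)
  qed
  then obtain ls1 s1 where 1: "exec B sort_vertices ?s ls1 s1" "Flush \<notin> set ls1" "puts ls1 = []"
    "length ls1 \<le> n * (n * 6 + 13) + 4" "\<forall>j<n. s1 ''p'' (pos j) = j" "unchanged sort_vertices ?s s1"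
    by (rule wp_exec) (simp add: pos_def position_def n_def)
  have s1p: "s1 ''p'' v = p v" if "v < n" for v
    using 1(5) p_less[OF that] pos_p[OF that] by metis
  have "loaded s1"
    unfolding loaded_def
  proof (intro conjI allI impI)
    show "s1 ''n'' 0 = n" "s1 ''m'' 0 = m" using 1(6) by (simp_all add: unchanged_def input_def n_def m_def)
    fix e v assume ev: "e < m" "v < n"
    have "e * n + p v < Suc e * n" using p_less[OF ev(2)] by simp
    also have "\<dots> \<le> m * n" using ev(1) by (intro mult_le_mono1) simp
    finally have "e * n + p v < m * n" .
    moreover have "s1 ''inc'' = ?s ''inc''" using 1(6) by (simp add: unchanged_def)
    ultimately show "s1 ''inc'' (e * n + s1 ''p'' v) = of_bool (J e v)"
      using p_less[OF ev(2)] s1p[OF ev(2)] by (simp add: input_def J_def f_def flip: n_def m_def)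
  qed
  from exec_enumerate[OF this] obtain ls2 s2 Ts where
    2: "exec B enumerate s1 ls2 s2" "outputs ls2 = map (code n (s1 ''p'')) Ts"
      "distinct Ts" "set Ts = transversals" "sorted_wrt lex_before Ts"
      "\<forall>t. \<forall>g\<in>set (gaps_from t ls2). g \<le> t + extend_time + ascend_time + descend_time"
    by blast
  let ?pre = "Tick # ls1 @ [Tick]"
  have "exec B algorithm ?s (Tick # (ls1 @ Tick # ls2)) s2"
    unfolding algorithm_def using m
    by (intro exec_CondT exec_Seq[OF 1(1) 2(1)]) (simp add: input_def)
  then have "exec B algorithm ?s (?pre @ ls2) s2" by simp
  moreover have "enumerates_lex vs r (outputs (?pre @ ls2)) (Tr V H)"
  proof -
    have "code n (s1 ''p'') T = code n p T" for T
      unfolding code_def using s1p by (intro map_cong) auto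
    then have out: "outputs (?pre @ ls2) = map (code n p) Ts"
      using 1(2,3) 2(2) unfolding outputs_def by (subst outputs_from_append) simp_all
    have sub: "T \<subseteq> {..<n}" if "T \<in> set Ts" for T using that 2(4) transversals_subset by blast
    have "list_all2 (represents vs) (map (code n p) Ts) (map ((`) f) Ts)"
      unfolding list_all2_map1 list_all2_map2
      using represents_code[OF p[unfolded n_def]] sub
      by (intro list.rel_refl_strong) (simp add: n_def f_def[abs_def])
    moreover have "distinct (map ((`) f) Ts)"
      unfolding distinct_map
    proof (intro conjI inj_onI)
      show "distinct Ts" by (rule 2(3))
    next
      fix S T assume "S \<in> set Ts" "T \<in> set Ts" "f ` S = f ` T"
      then show "S = T" using inj_on_image_eq_iff[OF inj sub sub] by blast
    qed
    moreover have "set (map ((`) f) Ts) = Tr V H" using 2(4) Tr by simp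
    moreover have "sorted_wrt (lex_le r) (map ((`) f) Ts)"
      unfolding sorted_wrt_map
      using 2(5) by (rule sorted_wrt_mono_rel[rotated]) (intro lex_le_image[OF r f mono] sub)
    ultimately show ?thesis unfolding enumerates_lex_def out by blast
  qed
  moreover have "delay (?pre @ ls2) \<le> 900 * ((n + 1) ^ 2 * m ^ (hrank (Tr V H) + 2))"
  proof (rule delay_le)
    fix g assume "g \<in> set (gaps_from 0 (?pre @ ls2))"
    also have "gaps_from 0 (?pre @ ls2) = gaps_from (length ?pre) ls2"
      using 1(2) by (subst gaps_from_append) simp_all
    finally have "g \<le> length ?pre + extend_time + ascend_time + descend_time" using 2(6) by blast
    also have "\<dots> \<le> 900 * ((n + 1) ^ 2 * m ^ (hrank (Tr V H) + 2))"
    proof -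
      \<comment> \<open>A gap is charged n tests for an ascent, n for a descent and one for the
        root, which makes 560 the main coefficient; as M >= 1, sorting, printing and control fit
        into the rest of 900.\<close>
      define M where "M = m ^ (hrank (Tr V H) + 2)"
      have "1 \<le> M" using m_pos by (simp add: M_def)
      then have M: "n \<le> n * M" "n * n \<le> n * (n * M)" by simp_all
      have E: "extend_time = 280 * (n * M) + 280 * M"
        by (simp add: extend_time_def M_def rank algebra_simps)
      have "n * extend_time = 280 * (n * (n * M)) + 280 * (n * M)"
        unfolding E by (simp add: algebra_simps)
      moreover have "length ?pre \<le> 6 * (n * n) + 13 * n + 6"
        using 1(4) by (simp add: algebra_simps)
      moreover have "ascend_time = n * extend_time + 9 * n + 6" "descend_time = n * extend_time + 17 * n + 12"
        by (simp_all add: ascend_time_def descend_time_def algebra_simps)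
      moreover have "(n + 1) ^ 2 * M = n * (n * M) + 2 * (n * M) + M"
        by (simp add: power2_eq_square algebra_simps)
      ultimately have "length ?pre + extend_time + ascend_time + descend_time \<le> 900 * ((n + 1) ^ 2 * M)"
        using M \<open>1 \<le> M\<close> E by linarith
      then show ?thesis by (simp add: M_def)
    qed
    finally show "g \<le> 900 * ((n + 1) ^ 2 * m ^ (hrank (Tr V H) + 2))" .
  qed
  ultimately show ?thesis by blast
qed

lemma exec_algorithm_0: "exec B algorithm (input vs [] r) [Tick, Flush] (input vs [] r)"
  unfolding algorithm_def by (intro exec_CondF exec_Output) (simp add: input_def)

lemma Tr_no_edges: "Tr V {} = {{}}"
  by (auto simp: Tr_def minimal_hitting_set_def hitting_set_def)

lemma exec_algorithm:
  fixes V :: "'a set"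
  assumes "hypergraph V H" "linear_order_on V r" "distinct vs" "set vs = V" "distinct es" "set es = H"
    and "length vs + length es + 1 \<le> B"
  shows "\<exists>ls s. exec B algorithm (input vs es r) ls s \<and> enumerates_lex vs r (outputs ls) (Tr V H) \<and>
    delay ls \<le> 3600 * max 1 (length es ^ (hrank (Tr V H) + 2) * length vs ^ 2)"
proof (cases "length es = 0")
  case True
  then have "es = []" "H = {}" using assms(6) by simp_all
  moreover have "enumerates_lex vs r (outputs [Tick, Flush]) (Tr V {})"
    unfolding enumerates_lex_def Tr_no_edges
    by (intro exI[of _ "[{}]"]) (simp add: outputs_def represents_def)
  moreover have "delay [Tick, Flush] \<le> 3600 * max 1 k" for k by (simp add: delay_def)
  ultimately show ?thesis using exec_algorithm_0[of B vs r] by blast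
next
  case False
  define n where "n = length vs"
  define M where "M = length es ^ (hrank (Tr V H) + 2)"
  from exec_algorithm_pos[OF assms(1-4,6) _ assms(7)] False obtain ls s where
    *: "exec B algorithm (input vs es r) ls s" "enumerates_lex vs r (outputs ls) (Tr V H)"
      "delay ls \<le> 900 * ((n + 1) ^ 2 * M)"
    unfolding n_def M_def by blast
  \<comment> \<open>For n > 0, (n + 1)^2 <= 4 n^2 gives 3600 = 4 * 900. For n = 0 only the empty
    edge is possible, so there is exactly one edge and the left side is 900.\<close>
  have "900 * ((n + 1) ^ 2 * M) \<le> 3600 * max 1 (M * n ^ 2)"
  proof (cases "n = 0")
    case True
    then have "H \<subseteq> {{}}" using assms(1,4) by (auto simp: hypergraph_def n_def)
    then have "length es \<le> 1" using distinct_card[OF assms(5)] card_mono[of "{{}}" H] assms(6) by simp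
    then have "length es = 1" using False by linarith
    then show ?thesis using True by (simp add: M_def)
  next
    case False
    then have "(n + 1) ^ 2 \<le> (2 * n) ^ 2" by (intro power_mono) simp_all
    then have "(n + 1) ^ 2 * M \<le> (2 * n) ^ 2 * M" by (rule mult_le_mono1)
    also have "\<dots> = 4 * (M * n ^ 2)" by (simp add: power2_eq_square)
    finally have "900 * ((n + 1) ^ 2 * M) \<le> 3600 * (M * n ^ 2)" by linarith
    also have "\<dots> \<le> 3600 * max 1 (M * n ^ 2)" by simp
    finally show ?thesis .
  qed
  with * show ?thesis unfolding n_def M_def by (meson le_trans)
qed

(* "max 1" matters only if m = 0 or n = 0, where the product vanishes but one step is needed. *)

theorem theorem4p1:
  shows "\<exists>(P :: com) (c :: nat) (q :: nat poly).
    \<forall>(V :: 'a set) H r vs es n m k.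
      hypergraph V H \<longrightarrow> linear_order_on V r \<longrightarrow>
      distinct vs \<longrightarrow> set vs = V \<longrightarrow> distinct es \<longrightarrow> set es = H \<longrightarrow>
      n = card V \<longrightarrow> m = card H \<longrightarrow> k = hrank (Tr V H) \<longrightarrow>
        (\<exists>ls s. steps (P, input vs es r) ls (Skip, s) \<and>
           enumerates_lex vs r (outputs ls) (Tr V H) \<and>
           delay ls \<le> c * max 1 (m ^ (k + 2) * n ^ 2)) \<and>
        (\<forall>ls d s. steps (P, input vs es r) ls (d, s) \<longrightarrow>
           words_bounded (poly q (n + m)) s \<and> space_bounded (poly q (n + m)) s)"
proof -
  define A where "A = writes algorithm \<union> {''n'', ''m'', ''ord'', ''inc''}"
  \<comment> \<open>\<open>b\<close> is (X + 1)^2, the bound on cells; \<open>q\<close> adds the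
    bound on bits to it and so dominates word size and space alike. \<open>A\<close> depends on the
    program alone, so its cardinality may serve as a coefficient.\<close>
  define b :: "nat poly" where "b = [:1, 1:] ^ 2"
  define q where "q = b + [:card A:] * (b + 1) * ([:2:] * b)"
  show ?thesis
  proof (intro exI[of _ algorithm] exI[of _ "3600 :: nat"] exI[of _ q] allI impI, goal_cases)
    case (1 V H r vs es n m k)
    have n: "n = length vs" using 1(3,4,7) distinct_card by metis
    have m: "m = length es" using 1(5,6,8) distinct_card by metis
    define B where "B = (length vs + length es + 1) ^ 2"
    have "length vs + length es + 1 \<le> B" by (simp add: B_def power2_eq_square)
    from exec_algorithm[OF 1(1-6) this] obtain ls s where
      *: "exec B algorithm (input vs es r) ls s" "enumerates_lex vs r (outputs ls) (Tr V H)"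
        "delay ls \<le> 3600 * max 1 (length es ^ (hrank (Tr V H) + 2) * length vs ^ 2)"
      by blast
    have "cells_bounded B {''n'', ''m'', ''ord'', ''inc''} (input vs es r)"
      unfolding B_def by (rule cells_bounded_input)
    then have "cells_bounded B A (input vs es r)"
      unfolding cells_bounded_def A_def by blast
    then have path: "path (cells_bounded B A) (algorithm, input vs es r) ls (Skip, s)"
      using exec_path[OF *(1)] A_def by blast
    have "poly b (n + m) = B" by (simp add: b_def B_def n m)
    then have q: "poly q (n + m) = B + card A * (B + 1) * (2 * B)"
      by (simp add: q_def algebra_simps)
    have "words_bounded (poly q (n + m)) s' \<and> space_bounded (poly q (n + m)) s'"
      if "steps (algorithm, input vs es r) ls' (d, s')" for ls' d s'
    proof -
      have s': "cells_bounded B A s'" using path_reachable[OF path that] by simp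
      have "finite A" by (simp add: A_def finite_writes)
      with s' have "space_bounded (card A * (B + 1) * (2 * B)) s'" by (rule cells_bounded_space)
      moreover have "s' a i \<le> B" for a i using s' by (simp add: cells_bounded_def)
      ultimately show ?thesis
        unfolding q words_bounded_def space_bounded_def by (meson le_add1 le_add2 le_trans)
    qed
    then show ?case
      using path_steps[OF path] *(2,3) 1(9) n m by blast
  qed
qed

end
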